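(* Let $\varphi\in\mathcal{L-P^*}$ be not of the form $Ce^{\beta z}$ with $C,\beta\in\mathbb{R}$. Then there exists a real number $\sigma_*$ such that $\psi_*(z)=e^{-\sigma_* z}\varphi(z)$ possesses property A. Moreover, if $Z_\mathbb{R}(Q)\neq0$, where $Q=Q[\varphi]$, then $Z_\mathbb{C}(\psi'_* )<Z_\mathbb{C}(\psi_* )$.
   Context: The Laguerre-P\'olya class $\mathcal{L-P}$ consists of the functions $$f(z)=cz^de^{-\gamma z^{2}+q(z)}\prod_{j=1}^{\omega}\left(1-\frac{z}{\alpha_j}\right)e^{\frac{z}{\alpha_j}+\ldots+\frac{z^{l}}{l\alpha_j^{l}}},\quad 0\leqslant\omega\leqslant\infty,$$ where $\gamma\geqslant0$, $q$ is a real polynomial with $\deg q\leqslant1$, $l\leqslant1$ is a nonnegative integer (no exponential factors in the product if $l=0$), $\alpha_j\in\mathbb{R}\setminus\{0\}$, $\sum_j|\alpha_j|^{-l-1}<\infty$, $d$ is a nonnegative integer, $c\in\mathbb{R}$, $c\neq0$. The class $\mathcal{L-P^*}$ consists of the functions $\varphi=pf$ with $f\in\mathcal{L-P}$ and $p$ a real polynomial with no real zeroes (nonzero constants allowed). For a real entire function $\varphi$, $Q[\varphi]=\left(\varphi'/\varphi\right)'=\frac{\varphi\varphi''-(\varphi')^2}{\varphi^2}$. $Z_{\mathbb{R}}(f)$ is the number of real zeroes of $f$ and $Z_{\mathbb{C}}(f)$ the number of nonreal zeroes of $f$, both counting multiplicities. Property A: let $\varphi\in\mathcal{L-P^*}$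 and let $\alpha$ be a real zero of $\varphi$. Suppose that $\beta_1$ and $\beta_2$, $\beta_1<\alpha<\beta_2$, are real zeroes of $\varphi'$ such that $\varphi'(z)\neq0$ for $z\in(\beta_1,\alpha)\cup(\alpha,\beta_2)$. The function $\varphi$ is said to possess property A at its real zero $\alpha$ if $Q[\varphi]$ has no real zeroes in at least one of the intervals $(\beta_1,\alpha)$ and $(\alpha,\beta_2)$. If $\alpha$ is the smallest zero of $\varphi$, then set $\beta_1=-\infty$, and if $\alpha$ is the largest zero of $\varphi$, then set $\beta_2=+\infty$. A function $\varphi\in\mathcal{L-P^*}$ is said to possess property A if it possesses property A at each of its real zeroes; in particular, $\varphi$ without real zeroes possesses property A.
   Formalization: In property A, an endpoint is infinite only if φ' has no zero beyond the smallest (largest) zero α; otherwise it is the nearest zero of φ'. Taken literally the claim fails for z((z-5)^2+ε)((z+5)^2+ε) with small ε>0. *)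

theory Defs
  imports "HOL-Complex_Analysis.Complex_Analysis" "HOL-Library.Extended_Nat"
    "HOL-Library.Extended_Real"
begin

abbreviation cpoly :: "real poly \<Rightarrow> complex \<Rightarrow> complex" where
  "cpoly p \<equiv> poly (map_poly complex_of_real p)"

text \<open>The zeros are numbered from 0, so \<open>j\<close> ranges over \<open>enat j < \<omega>\<close>; for finite \<open>\<omega>\<close> the
  remaining factors are 1, and \<open>\<omega> = 0\<close> gives the empty product.\<close>

definition weierstrass_factor :: "enat \<Rightarrow> nat \<Rightarrow> (nat \<Rightarrow> real) \<Rightarrow> nat \<Rightarrow> complex \<Rightarrow> complex" where
  "weierstrass_factor \<omega> l \<alpha> j z =
     (if enat j < \<omega>
      then (1 - z / of_real (\<alpha> j)) * exp (\<Sum>k=1..l. z ^ k / (of_nat k * of_real (\<alpha> j) ^ k))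
      else 1)"

definition laguerre_polya :: "(complex \<Rightarrow> complex) set" where
  "laguerre_polya = {f. \<exists>(c::real) (d::nat) (\<gamma>::real) (q::real poly) (l::nat) (\<omega>::enat) (\<alpha>::nat \<Rightarrow> real).
     c \<noteq> 0 \<and> \<gamma> \<ge> 0 \<and> degree q \<le> 1 \<and> l \<le> 1 \<and>
     (\<forall>j. enat j < \<omega> \<longrightarrow> \<alpha> j \<noteq> 0) \<and>
     summable (\<lambda>j. if enat j < \<omega> then 1 / \<bar>\<alpha> j\<bar> ^ (l + 1) else 0) \<and>
     (\<forall>z. f z = of_real c * z ^ d * exp (- of_real \<gamma> * z ^ 2 + cpoly q z) *
                (\<Prod>j. weierstrass_factor \<omega> l \<alpha> j z))}"

definition laguerre_polya_star :: "(complex \<Rightarrow> complex) set" where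
  "laguerre_polya_star = {\<phi>. \<exists>f \<in> laguerre_polya. \<exists>p :: real poly.
     (\<forall>x. poly p x \<noteq> 0) \<and> (\<forall>z. \<phi> z = cpoly p z * f z)}"

definition Qfun :: "(complex \<Rightarrow> complex) \<Rightarrow> complex \<Rightarrow> complex" where
  "Qfun \<phi> = deriv (\<lambda>z. deriv \<phi> z / \<phi> z)"

text \<open>Analyticity at the point excludes the poles of a meromorphic function, where the HOL
  function takes an arbitrary value (possibly 0).\<close>

definition zeros :: "(complex \<Rightarrow> complex) \<Rightarrow> complex set" where
  "zeros f = {z. f analytic_on {z} \<and> f z = 0}"

definition count_zeros :: "(complex \<Rightarrow> complex) \<Rightarrow> complex set \<Rightarrow> enat" where
  "count_zeros f A =
     (if finite (zeros f \<inter> A) then enat (\<Sum>z\<in>zeros f \<inter> A. nat (zorder f z)) else \<infinity>)"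

definition Z_R :: "(complex \<Rightarrow> complex) \<Rightarrow> enat" where
  "Z_R f = count_zeros f \<real>"

definition Z_C :: "(complex \<Rightarrow> complex) \<Rightarrow> enat" where
  "Z_C f = count_zeros f (- \<real>)"

abbreviation real_zero :: "(complex \<Rightarrow> complex) \<Rightarrow> real \<Rightarrow> bool" where
  "real_zero f x \<equiv> complex_of_real x \<in> zeros f"

text \<open>The endpoints \<open>\<beta>\<^sub>1 < \<alpha> < \<beta>\<^sub>2\<close> of property A are the zeros of \<open>\<phi>'\<close> next to \<open>\<alpha>\<close>.
  A missing neighbour is replaced by an infinite endpoint; by Rolle, it can be missing on the left
  (right) only if \<open>\<alpha>\<close> is the smallest (largest) real zero. If \<open>\<alpha>\<close> is the smallest zero but
  \<open>\<phi>'\<close> does vanish to the left of \<open>\<alpha>\<close>, the endpoint is that zero of \<open>\<phi>'\<close>, not \<open>-\<infinity>\<close>: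
  otherwise, for small \<open>\<epsilon> > 0\<close>, no function \<open>exp (- \<sigma> z) * z * ((z - 5)^2 + \<epsilon>) * ((z + 5)^2 + \<epsilon>)\<close>
  would have property A.\<close>

definition left_endpoint :: "(complex \<Rightarrow> complex) \<Rightarrow> real \<Rightarrow> ereal \<Rightarrow> bool" where
  "left_endpoint \<phi> \<alpha> \<beta>\<^sub>1 \<longleftrightarrow>
     \<beta>\<^sub>1 < ereal \<alpha> \<and>
     (\<forall>x. \<beta>\<^sub>1 < ereal x \<and> x < \<alpha> \<longrightarrow> \<not> real_zero (deriv \<phi>) x) \<and>
     ((\<exists>b. \<beta>\<^sub>1 = ereal b \<and> real_zero (deriv \<phi>) b) \<or>
      (\<beta>\<^sub>1 = -\<infinity> \<and> (\<forall>x. real_zero \<phi> x \<longrightarrow> \<alpha> \<le> x)))"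

definition right_endpoint :: "(complex \<Rightarrow> complex) \<Rightarrow> real \<Rightarrow> ereal \<Rightarrow> bool" where
  "right_endpoint \<phi> \<alpha> \<beta>\<^sub>2 \<longleftrightarrow>
     ereal \<alpha> < \<beta>\<^sub>2 \<and>
     (\<forall>x. \<alpha> < x \<and> ereal x < \<beta>\<^sub>2 \<longrightarrow> \<not> real_zero (deriv \<phi>) x) \<and>
     ((\<exists>b. \<beta>\<^sub>2 = ereal b \<and> real_zero (deriv \<phi>) b) \<or>
      (\<beta>\<^sub>2 = \<infinity> \<and> (\<forall>x. real_zero \<phi> x \<longrightarrow> x \<le> \<alpha>)))"

definition property_A_at :: "(complex \<Rightarrow> complex) \<Rightarrow> real \<Rightarrow> bool" where
  "property_A_at \<phi> \<alpha> \<longleftrightarrow>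
     (\<exists>\<beta>\<^sub>1 \<beta>\<^sub>2. left_endpoint \<phi> \<alpha> \<beta>\<^sub>1 \<and> right_endpoint \<phi> \<alpha> \<beta>\<^sub>2 \<and>
       ((\<forall>x. \<beta>\<^sub>1 < ereal x \<and> x < \<alpha> \<longrightarrow> \<not> real_zero (Qfun \<phi>) x) \<or>
        (\<forall>x. \<alpha> < x \<and> ereal x < \<beta>\<^sub>2 \<longrightarrow> \<not> real_zero (Qfun \<phi>) x)))"

definition property_A :: "(complex \<Rightarrow> complex) \<Rightarrow> bool" where
  "property_A \<phi> \<longleftrightarrow>
     \<phi> \<in> laguerre_polya_star \<and> (\<forall>\<alpha>. real_zero \<phi> \<alpha> \<longrightarrow> property_A_at \<phi> \<alpha>)"

end

theory Submission
  imports Defs "HOL-Computational_Algebra.Fundamental_Theorem_Algebra"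
begin

text \<open>
Write \<open>\<phi> = p f\<close> with \<open>f\<close> in the Laguerre--Polya class and \<open>p\<close> a real polynomial without real
zeros, and let \<open>L = \<phi>'/\<phi>\<close>, so that \<open>Q = L'\<close>. Multiplying \<open>\<phi>\<close> by \<open>exp (- \<sigma> z)\<close> replaces \<open>L\<close> by
\<open>L - \<sigma>\<close> and does not change \<open>Q\<close>. The number \<open>\<sigma>\<close> is the largest value of \<open>L\<close> at a real
critical point of \<open>L\<close>, that is, at a real zero of \<open>Q\<close> (any \<open>\<sigma>\<close> will do if there is none).

Property A. To the right of a zero \<open>\<alpha>\<close>, up to the next zero of \<open>\<psi>'\<close>, the quotient
\<open>\<psi>'/\<psi> = L - \<sigma>\<close> starts from \<open>+\<infinity>\<close> and does not vanish, so \<open>L > \<sigma>\<close> there. By the choice of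
\<open>\<sigma>\<close> no critical point of \<open>L\<close> lies in this interval: \<open>Q\<close> has no zero to the right of any \<open>\<alpha>\<close>
(lemmas \<open>logderiv_positive_right_of_zero\<close> and \<open>property_A_at_criterion\<close>).

The maximum exists because the set of critical points is compact. It is closed, since \<open>Q\<close> has a
double pole at every zero of \<open>\<phi>\<close> (\<open>Qfun_tendsto_at_zero\<close>). It is bounded, since
\<open>\<phi> \<phi>'' - \<phi>'\<^sup>2 = p\<^sup>2 (f f'' - f'\<^sup>2) + f\<^sup>2 (p p'' - p'\<^sup>2)\<close>, where the first term is \<open>\<le> 0\<close> on the
real line by the Laguerre inequality, and the second is negative near infinity because
\<open>p p'' - p'\<^sup>2\<close> has even degree \<open>2 m - 2\<close> and a negative leading coefficient if \<open>m = deg p > 0\<close>.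
If \<open>p\<close> is constant, there are no critical points at all, by the next paragraph.

Nonreal zeros. At a critical point \<open>x\<close> with \<open>L x = \<sigma>\<close>, the derivative \<open>\<psi>'\<close> has a real zero of
order at least 2 which is not a zero of \<open>\<psi>\<close>. For real polynomials, Rolle's theorem says that the
derivative has at most one real zero less than the polynomial, hence no more nonreal ones; but if
the derivative has two zeros in an interval without zeros of the polynomial, then it has strictly
fewer nonreal zeros. This passes to \<open>\<psi>\<close> by approximation: \<open>\<psi>\<close> is a locally uniform limit of real
polynomials with at most \<open>m\<close> nonreal zeros, and by Rouche's theorem the zeros of their derivatives
accumulate at those of \<open>\<psi>'\<close> with the right multiplicities. If \<open>\<psi>'\<close> had \<open>m\<close> nonreal zeros, then
some approximating derivative would have \<open>m\<close> nonreal zeros near them and, in addition, two zeros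
near \<open>x\<close>; whether the latter are real or not, this is too many. Hence
\<open>Z_C \<psi>' < m\<close> (\<open>nonreal_zeros_deriv_less\<close>), while \<open>Z_C \<psi> = m\<close>.
\<close>

section \<open>Real polynomials and their complex zeros\<close>

lemma map_poly_of_real_mult:
  "map_poly complex_of_real (p * q) = map_poly complex_of_real p * map_poly complex_of_real q"
  by (rule poly_eqI) (simp add: coeff_map_poly coeff_mult)

lemma map_poly_of_real_power:
  "map_poly complex_of_real (p ^ n) = map_poly complex_of_real p ^ n"
  by (induction n) (simp_all add: map_poly_of_real_mult)

lemma map_poly_of_real_pderiv:
  "map_poly complex_of_real (pderiv p) = pderiv (map_poly complex_of_real p)"
  by (rule poly_eqI) (simp add: coeff_map_poly coeff_pderiv)

lemma cpoly_of_real [simp]: "cpoly p (of_real x) = of_real (poly p x)"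
  by (induction p) (simp_all add: map_poly_pCons)

lemma map_poly_of_real_eq_0_iff: "map_poly complex_of_real p = 0 \<longleftrightarrow> p = 0"
  by (simp add: poly_eq_iff coeff_map_poly)

lemma degree_map_poly_of_real: "degree (map_poly complex_of_real p) = degree p"
  by (rule degree_map_poly) simp

lemma order_of_real:
  assumes "p \<noteq> 0"
  shows "order (of_real x) (map_poly complex_of_real p) = order x p"
proof -
  obtain k where k: "order x p = k" by blast
  obtain q where p: "p = [:-x, 1:] ^ k * q" and q: "poly q x \<noteq> 0"
    using order_decomp[OF assms, of x] unfolding k by (auto simp: poly_eq_0_iff_dvd)
  have "map_poly complex_of_real p = [:- of_real x, 1:] ^ k * map_poly complex_of_real q"
    unfolding p by (simp only: map_poly_of_real_mult map_poly_of_real_power) (simp add: map_poly_pCons)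
  moreover have "order (of_real x) (map_poly complex_of_real q) = 0"
    using q by (intro order_0I) simp
  moreover have "map_poly complex_of_real p \<noteq> 0"
    using assms by (simp add: map_poly_of_real_eq_0_iff)
  ultimately show ?thesis
    using k by (simp add: order_mult order_power_n_n)
qed

lemma size_proots_eq_sum:
  assumes "p \<noteq> 0" "finite A" "{x. poly p x = 0} \<subseteq> A"
  shows "size (proots p) = (\<Sum>x\<in>A. order x p)"
proof -
  have "size (proots p) = (\<Sum>x\<in>{x. poly p x = 0}. order x p)"
    using assms(1) by (simp add: size_multiset_overloaded_eq)
  also have "\<dots> = (\<Sum>x\<in>A. order x p)"
    using assms by (intro sum.mono_neutral_left) (auto simp: order_gt_0_iff)
  finally show ?thesis .
qed

lemma sum_order_le_size_proots:
  assumes "p \<noteq> 0" "finite A"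
  shows "(\<Sum>x\<in>A. order x p) \<le> size (proots p)"
proof -
  have "(\<Sum>x\<in>A. order x p) \<le> (\<Sum>x\<in>A \<union> {x. poly p x = 0}. order x p)"
    using assms by (intro sum_mono2) (auto simp: poly_roots_finite)
  also have "\<dots> = size (proots p)"
    using assms by (subst size_proots_eq_sum) (auto simp: poly_roots_finite)
  finally show ?thesis .
qed

text \<open>The nonreal zeros are counted by what remains of the degree after the real zeros have been
  taken out; this is how counts of real zeros give bounds on nonreal ones.\<close>
lemma sum_order_nonreal_add_size_proots_le:
  assumes "P \<noteq> 0" "finite T" "T \<inter> \<real> = {}"
  shows "(\<Sum>z\<in>T. order z (map_poly complex_of_real P)) + size (proots P) \<le> degree P"
proof -
  let ?C = "map_poly complex_of_real P" and ?S = "{x. poly P x = 0}"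
  have nz: "?C \<noteq> 0" using assms by (simp add: map_poly_of_real_eq_0_iff)
  have fin: "finite ?S" using assms by (simp add: poly_roots_finite)
  have "size (proots P) = (\<Sum>x\<in>?S. order x P)"
    using assms fin by (intro size_proots_eq_sum) auto
  also have "\<dots> \<le> (\<Sum>x\<in>?S. order (of_real x) ?C)"
    using assms by (intro sum_mono eq_refl order_of_real [symmetric])
  also have "\<dots> = (\<Sum>z\<in>of_real ` ?S. order z ?C)"
    by (subst sum.reindex) (auto simp: inj_on_def)
  finally have "(\<Sum>z\<in>T. order z ?C) + size (proots P)
      \<le> (\<Sum>z\<in>T. order z ?C) + (\<Sum>z\<in>of_real ` ?S. order z ?C)" by simp
  also have "\<dots> = (\<Sum>z\<in>T \<union> of_real ` ?S. order z ?C)"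
    using assms fin by (intro sum.union_disjoint [symmetric]) (auto simp: Reals_def)
  also have "\<dots> \<le> size (proots ?C)"
    using nz assms fin by (intro sum_order_le_size_proots) auto
  also have "\<dots> \<le> degree P"
    by (metis size_proots_le degree_map_poly_of_real)
  finally show ?thesis .
qed

text \<open>Rolle's theorem between neighbouring points of \<open>S\<close>. The last clause, that the chosen zeros
  of the derivative are separated by points of \<open>S\<close>, makes at most one of them lie in a given gap.\<close>
lemma Rolle_points:
  fixes P :: "real poly"
  assumes "finite S" "\<And>x. x \<in> S \<Longrightarrow> poly P x = 0" "P \<noteq> 0"
  shows "\<exists>X. finite X \<and> card S \<le> card X + 1 \<and>
     (\<forall>x\<in>X. poly (pderiv P) x = 0 \<and> x \<notin> S \<and> (\<exists>s\<in>S. x < s)) \<and>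
     (\<forall>x\<in>X. \<forall>y\<in>X. x < y \<longrightarrow> (\<exists>s\<in>S. x < s \<and> s < y))"
  using assms(1,2)
proof (induction S rule: finite_linorder_max_induct)
  case empty
  show ?case by (intro exI[of _ "{}"]) auto
next
  case (insert b A)
  then obtain X where X: "finite X" "card A \<le> card X + 1"
     "\<forall>x\<in>X. poly (pderiv P) x = 0 \<and> x \<notin> A \<and> (\<exists>s\<in>A. x < s)"
     "\<forall>x\<in>X. \<forall>y\<in>X. x < y \<longrightarrow> (\<exists>s\<in>A. x < s \<and> s < y)"
    by auto
  show ?case
  proof (cases "A = {}")
    case True
    then show ?thesis by (intro exI[of _ "{}"]) auto
  next
    case False
    define m where "m = Max A"
    have m: "m \<in> A" "\<And>a. a \<in> A \<Longrightarrow> a \<le> m"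
      using insert False by (auto simp: m_def)
    have "m < b" using insert m by auto
    from poly_MVT[OF this, of P] obtain \<xi> where \<xi>: "m < \<xi>" "\<xi> < b" "poly (pderiv P) \<xi> = 0"
      using insert.prems m \<open>m < b\<close> by auto
    have below: "x < m" if "x \<in> X" for x
      using X(3) m(2) that by (meson less_le_trans)
    have "\<xi> \<notin> X" using below \<xi> by force
    then have "card (insert b A) \<le> card (insert \<xi> X) + 1"
      using X insert by (auto simp: card_insert_if)
    moreover have "\<forall>x\<in>insert \<xi> X. poly (pderiv P) x = 0 \<and> x \<notin> insert b A \<and> (\<exists>s\<in>insert b A. x < s)"
      using X(3) \<xi> m \<open>m < b\<close> below by force
    moreover have "\<forall>x\<in>insert \<xi> X. \<forall>y\<in>insert \<xi> X. x < y \<longrightarrow> (\<exists>s\<in>insert b A. x < s \<and> s < y)"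
    proof (intro ballI impI)
      fix x y assume xy: "x \<in> insert \<xi> X" "y \<in> insert \<xi> X" "x < y"
      show "\<exists>s\<in>insert b A. x < s \<and> s < y"
      proof (cases "y = \<xi>")
        case True
        then have "x < m" using xy below by auto
        then show ?thesis using True \<xi> m by blast
      next
        case False
        then have "y < m" using xy below by blast
        then have "x \<in> X" using xy \<xi> by auto
        then show ?thesis using X(4) xy False by blast
      qed
    qed
    ultimately show ?thesis using X(1) by (intro exI[of _ "insert \<xi> X"]) auto
  qed
qed

text \<open>Each zero of \<open>P\<close> loses one order when \<open>P\<close> is differentiated, so the common zeros account
  for all but one unit per distinct zero; zeros of the derivative outside \<open>P\<close> come on top.\<close>
lemma size_proots_add_sum_order_le_pderiv:
  fixes P :: "real poly"
  assumes "P \<noteq> 0" "pderiv P \<noteq> 0" "finite X" "\<And>x. x \<in> X \<Longrightarrow> poly P x \<noteq> 0"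
  shows "size (proots P) + (\<Sum>x\<in>X. order x (pderiv P))
    \<le> size (proots (pderiv P)) + card {x. poly P x = 0}"
proof -
  let ?S = "{x. poly P x = 0}" and ?D = "pderiv P"
  have fin: "finite ?S" using assms by (simp add: poly_roots_finite)
  have "size (proots P) = (\<Sum>x\<in>?S. order x P)"
    using assms fin by (intro size_proots_eq_sum) auto
  also have "\<dots> = (\<Sum>x\<in>?S. order x ?D + 1)"
    using assms by (intro sum.cong) (auto simp: order_pderiv)
  finally have "size (proots P) = (\<Sum>x\<in>?S. order x ?D) + card ?S"
    by (simp add: sum_Suc)
  moreover have "(\<Sum>x\<in>?S. order x ?D) + (\<Sum>x\<in>X. order x ?D) = (\<Sum>x\<in>?S \<union> X. order x ?D)"
    using assms fin by (intro sum.union_disjoint [symmetric]) auto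
  moreover have "\<dots> \<le> size (proots ?D)"
    using assms fin by (intro sum_order_le_size_proots) auto
  ultimately show ?thesis by linarith
qed

lemma card_le_sum_order:
  fixes p :: "real poly"
  assumes "p \<noteq> 0" "\<And>x. x \<in> X \<Longrightarrow> poly p x = 0"
  shows "card X \<le> (\<Sum>x\<in>X. order x p)"
proof -
  have "1 \<le> order x p" if "x \<in> X" for x
    using assms that order_gt_0_iff[of p x] by force
  then show ?thesis using sum_mono[of X "\<lambda>_. 1" "\<lambda>x. order x p"] by simp
qed

text \<open>The Rolle points compensate all but one of the lost orders.\<close>
lemma size_proots_le_pderiv:
  fixes P :: "real poly"
  assumes P: "P \<noteq> 0" "pderiv P \<noteq> 0"
  shows "size (proots P) \<le> size (proots (pderiv P)) + 1"
proof -
  let ?S = "{x. poly P x = 0}"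
  obtain X where X: "finite X" "card ?S \<le> card X + 1"
     "\<forall>x\<in>X. poly (pderiv P) x = 0 \<and> x \<notin> ?S"
    using Rolle_points[OF poly_roots_finite[OF P(1)], of P] P by auto
  have "card X \<le> (\<Sum>x\<in>X. order x (pderiv P))"
    using X P by (intro card_le_sum_order) auto
  moreover have "size (proots P) + (\<Sum>x\<in>X. order x (pderiv P)) \<le> size (proots (pderiv P)) + card ?S"
    using X P by (intro size_proots_add_sum_order_le_pderiv) auto
  ultimately show ?thesis using X(2) by linarith
qed

text \<open>The interval \<open>(u, v)\<close> contains at most one Rolle point. Exchanging this point for all the
  zeros \<open>T\<close> of the derivative in the interval costs 1, whence the constant 2. If \<open>T\<close> has at least
  two zeros, the derivative has no fewer real zeros than \<open>P\<close>, although its degree is smaller.\<close>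
lemma size_proots_add_gap_roots_le_pderiv:
  fixes P :: "real poly"
  assumes P: "P \<noteq> 0" "pderiv P \<noteq> 0"
    and T: "finite T" "T \<subseteq> {u<..<v}"
    and free: "\<And>x. u < x \<Longrightarrow> x < v \<Longrightarrow> poly P x \<noteq> 0"
  shows "size (proots P) + (\<Sum>t\<in>T. order t (pderiv P)) \<le> size (proots (pderiv P)) + 2"
proof -
  let ?S = "{x. poly P x = 0}" and ?D = "pderiv P"
  obtain X where X: "finite X" "card ?S \<le> card X + 1"
     "\<forall>x\<in>X. poly ?D x = 0 \<and> x \<notin> ?S"
     "\<forall>x\<in>X. \<forall>y\<in>X. x < y \<longrightarrow> (\<exists>s\<in>?S. x < s \<and> s < y)"
    using Rolle_points[OF poly_roots_finite[OF P(1)], of P] P by auto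
  define Y where "Y = X - {u<..<v}"
  have "card (X \<inter> {u<..<v}) \<le> 1"
  proof -
    have "x = y" if xy: "x \<in> X \<inter> {u<..<v}" "y \<in> X \<inter> {u<..<v}" for x y
    proof (rule ccontr)
      assume "x \<noteq> y"
      then consider "x < y" | "y < x" by linarith
      then obtain s where "poly P s = 0" "u < s" "s < v"
      proof cases
        case 1
        then obtain s where "poly P s = 0" "x < s" "s < y" using X(4) xy by blast
        then show ?thesis using that xy by auto
      next
        case 2
        then obtain s where "poly P s = 0" "y < s" "s < x" using X(4) xy by blast
        then show ?thesis using that xy by auto
      qed
      then show False using free by blast
    qed
    then show ?thesis
      using X(1) by (simp add: card_le_Suc0_iff_eq)
  qed
  moreover have "card X = card (X \<inter> {u<..<v}) + card Y"
    unfolding Y_def using X(1) by (simp add: card_Int_Diff)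
  ultimately have Y: "card X \<le> card Y + 1" by simp
  have Yf: "finite Y" "Y \<subseteq> X" using X by (auto simp: Y_def)
  have "card Y \<le> (\<Sum>x\<in>Y. order x ?D)"
    using X P Yf by (intro card_le_sum_order) auto
  moreover have "(\<Sum>x\<in>Y \<union> T. order x ?D) = (\<Sum>x\<in>Y. order x ?D) + (\<Sum>x\<in>T. order x ?D)"
    using Yf T by (intro sum.union_disjoint) (auto simp: Y_def)
  moreover have "size (proots P) + (\<Sum>x\<in>Y \<union> T. order x ?D) \<le> size (proots ?D) + card ?S"
    using X P Yf T free by (intro size_proots_add_sum_order_le_pderiv) force+
  ultimately show ?thesis using X(2) Y by linarith
qed

section \<open>Locally uniform limits of polynomials with few nonreal zeros\<close>

text \<open>The multiset \<open>proots P\<close> contains the real zeros with multiplicity, so \<open>degree P\<close> minus its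
  size is the number of nonreal zeros. With \<open>m = 0\<close> the polynomial is real-rooted.\<close>
definition at_most_nonreal :: "nat \<Rightarrow> real poly \<Rightarrow> bool" where
  "at_most_nonreal m P \<longleftrightarrow> P \<noteq> 0 \<and> degree P \<le> size (proots P) + m"

lemma at_most_nonreal_mult:
  assumes "at_most_nonreal m P" "at_most_nonreal k Q"
  shows "at_most_nonreal (m + k) (P * Q)"
  using assms by (auto simp: at_most_nonreal_def proots_mult degree_mult_eq)

lemma at_most_nonreal_power:
  assumes "at_most_nonreal 0 P"
  shows "at_most_nonreal 0 (P ^ n)"
proof (induction n)
  case 0
  show ?case by (simp add: at_most_nonreal_def)
next
  case (Suc n)
  show ?case using at_most_nonreal_mult[OF assms Suc] by simp
qed

lemma at_most_nonreal_linear: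
  assumes "degree P \<le> 1" "P \<noteq> 0"
  shows "at_most_nonreal 0 P"
proof (cases "degree P = 0")
  case True
  then show ?thesis using assms by (simp add: at_most_nonreal_def)
next
  case False
  with assms have d: "degree P = 1" by simp
  obtain a Q where "P = pCons a Q" by (rule pCons_cases)
  moreover from this d have "degree Q = 0" "Q \<noteq> 0" by (auto split: if_splits)
  then obtain b where "Q = [:b:]" "b \<noteq> 0" by (auto elim: degree_eq_zeroE)
  ultimately have P: "P = [:a, b:]" "b \<noteq> 0" by auto
  have "- a / b \<in># proots P"
    using assms P by (subst set_count_proots) auto
  then have "size (proots P) \<ge> 1"
    by (cases "proots P") auto
  then show ?thesis using assms d by (simp add: at_most_nonreal_def)
qed

text \<open>Equivalent to being a locally uniform limit of a sequence of such polynomials. Quantifying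
  over the radius and the error instead makes the class closed under locally uniform limits without
  any diagonal argument.\<close>
definition approximable :: "nat \<Rightarrow> (complex \<Rightarrow> complex) \<Rightarrow> bool" where
  "approximable m f \<longleftrightarrow> (\<forall>R \<epsilon>. \<epsilon> > 0 \<longrightarrow>
     (\<exists>P. at_most_nonreal m P \<and> (\<forall>z. norm z \<le> R \<longrightarrow> norm (cpoly P z - f z) < \<epsilon>)))"

lemma approximableE:
  assumes "approximable m f" "\<epsilon> > 0"
  obtains P where "at_most_nonreal m P" "\<And>z. norm z \<le> R \<Longrightarrow> norm (cpoly P z - f z) < \<epsilon>"
  using assms unfolding approximable_def by blast

lemma approximable_cpoly: "at_most_nonreal m P \<Longrightarrow> approximable m (cpoly P)"
  unfolding approximable_def by (intro allI impI exI[of _ P]) auto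

lemma approximable_uniform_limit:
  assumes "\<And>N. approximable m (g N)"
    and lim: "\<And>R. uniform_limit (cball 0 R) g f sequentially"
  shows "approximable m f"
  unfolding approximable_def
proof (intro allI impI)
  fix R \<epsilon> :: real assume "\<epsilon> > 0"
  then have "\<forall>\<^sub>F N in sequentially. \<forall>z\<in>cball 0 R. dist (g N z) (f z) < \<epsilon> / 2"
    using uniform_limitD[OF lim, of "\<epsilon> / 2" R] by simp
  then obtain N where N: "\<forall>z\<in>cball 0 R. dist (g N z) (f z) < \<epsilon> / 2"
    using eventually_happens'[OF sequentially_bot] by blast
  obtain P where P: "at_most_nonreal m P" "\<And>z. norm z \<le> R \<Longrightarrow> norm (cpoly P z - g N z) < \<epsilon> / 2"
    using approximableE[OF assms(1)[of N], of "\<epsilon> / 2" R] \<open>\<epsilon> > 0\<close> by auto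
  have "norm (cpoly P z - f z) < \<epsilon>" if "norm z \<le> R" for z
    using norm_diff_triangle_less[of "cpoly P z" "g N z" "\<epsilon> / 2" "f z" "\<epsilon> / 2"]
      P(2)[OF that] N that by (simp add: dist_norm)
  then show "\<exists>P. at_most_nonreal m P \<and> (\<forall>z. norm z \<le> R \<longrightarrow> norm (cpoly P z - f z) < \<epsilon>)"
    using P by blast
qed

lemma approximable_bounded:
  assumes "approximable m f"
  obtains B where "B > 0" "\<And>z. norm z \<le> R \<Longrightarrow> norm (f z) \<le> B"
proof -
  obtain P where P: "at_most_nonreal m P" "\<And>z. norm z \<le> R \<Longrightarrow> norm (cpoly P z - f z) < 1"
    using approximableE[OF assms, of 1 R] by auto
  have "compact (cpoly P ` cball 0 R)"
    by (intro compact_continuous_image continuous_intros) auto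
  then obtain C where C: "C > 0" "\<And>z. norm z \<le> R \<Longrightarrow> norm (cpoly P z) \<le> C"
    using compact_imp_bounded[THEN bounded_pos[THEN iffD1]] by force
  show thesis
  proof
    show "C + 1 > 0" using C by simp
    show "norm (f z) \<le> C + 1" if "norm z \<le> R" for z
      using norm_triangle_ineq2[of "f z" "cpoly P z"] P(2)[OF that] C(2)[OF that]
      by (simp add: norm_minus_commute)
  qed
qed

lemma approximable_mult:
  assumes f: "approximable m f" and g: "approximable k g"
  shows "approximable (m + k) (\<lambda>z. f z * g z)"
  unfolding approximable_def
proof (intro allI impI)
  fix R \<epsilon> :: real assume "\<epsilon> > 0"
  obtain B where B: "B > 0" "\<And>z. norm z \<le> R \<Longrightarrow> norm (f z) \<le> B"
    using approximable_bounded[OF f] by blast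
  obtain C where C: "C > 0" "\<And>z. norm z \<le> R \<Longrightarrow> norm (g z) \<le> C"
    using approximable_bounded[OF g] by blast
  define e where "e = min 1 (\<epsilon> / (B + C + 1))"
  have e: "e > 0" "e \<le> 1" using \<open>\<epsilon> > 0\<close> B C by (auto simp: e_def)
  have "e \<le> \<epsilon> / (B + C + 1)" by (simp add: e_def)
  then have e': "e * (B + C + 1) \<le> \<epsilon>"
    using B C by (simp add: pos_le_divide_eq)
  obtain P where P: "at_most_nonreal m P" "\<And>z. norm z \<le> R \<Longrightarrow> norm (cpoly P z - f z) < e"
    using approximableE[OF f e(1)] by blast
  obtain Q where Q: "at_most_nonreal k Q" "\<And>z. norm z \<le> R \<Longrightarrow> norm (cpoly Q z - g z) < e"
    using approximableE[OF g e(1)] by blast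
  have "norm (cpoly (P * Q) z - f z * g z) < \<epsilon>" if z: "norm z \<le> R" for z
  proof -
    let ?a = "cpoly P z - f z" and ?b = "cpoly Q z - g z"
    have "cpoly (P * Q) z - f z * g z = ?a * ?b + ?a * g z + f z * ?b"
      by (simp add: map_poly_of_real_mult algebra_simps)
    also have "norm \<dots> \<le> norm ?a * norm ?b + norm ?a * norm (g z) + norm (f z) * norm ?b"
      using norm_triangle_ineq[of "?a * ?b + ?a * g z" "f z * ?b"]
        norm_triangle_ineq[of "?a * ?b" "?a * g z"]
      by (simp add: norm_mult)
    also have "\<dots> < e * 1 + e * C + B * e"
    proof -
      have "norm ?a * norm ?b \<le> norm ?a * 1"
        using Q(2)[OF z] e by (intro mult_left_mono) auto
      also have "\<dots> < e * 1" using P(2)[OF z] by simp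
      finally have 1: "norm ?a * norm ?b < e * 1" .
      have 2: "norm ?a * norm (g z) \<le> e * C"
        using P(2)[OF z] C(2)[OF z] e by (intro mult_mono) auto
      have 3: "norm (f z) * norm ?b \<le> B * e"
        using Q(2)[OF z] B(2)[OF z] B(1) by (intro mult_mono) auto
      show ?thesis using 1 2 3 by linarith
    qed
    also have "\<dots> \<le> \<epsilon>" using e' by (simp add: algebra_simps)
    finally show ?thesis .
  qed
  then show "\<exists>P. at_most_nonreal (m + k) P \<and> (\<forall>z. norm z \<le> R \<longrightarrow> norm (cpoly P z - f z * g z) < \<epsilon>)"
    using at_most_nonreal_mult[OF P(1) Q(1)] by blast
qed

text \<open>Compare \<open>1 + w/n\<close> with \<open>exp (w/n)\<close>: they differ by \<open>O(1/n\<^sup>2)\<close>, and taking \<open>n\<close>-th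
  powers multiplies the error by at most about \<open>n\<close>, because both have norm at most \<open>exp (B/n)\<close>.\<close>
lemma norm_exp_minus_power_le:
  fixes w :: complex
  assumes "norm w \<le> B" "n > 0"
  shows "norm ((1 + w / of_nat n) ^ n - exp w) \<le> exp (2 * B) * B\<^sup>2 / n"
proof -
  have B: "B \<ge> 0" using assms norm_ge_zero[of w] by linarith
  define u where "u = w / of_nat n"
  have u: "norm u \<le> B / n" "norm u \<le> B"
  proof -
    show "norm u \<le> B / n" using assms by (simp add: u_def norm_divide divide_right_mono)
    also have "\<dots> \<le> B" using assms B by (simp add: field_simps mult_le_cancel_left1)
    finally show "norm u \<le> B" .
  qed
  \<comment> \<open>Dividing by \<open>c\<close> puts both bases into the unit disc, where powers are Lipschitz with constant \<open>n\<close>.\<close>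
  define c where "c = exp (B / n)"
  have c: "c \<ge> 1" "c > 0" using B by (auto simp: c_def)
  have cn: "c ^ n = exp B" using assms by (simp add: c_def flip: exp_of_nat_mult)
  have 1: "norm (exp u / of_real c) \<le> 1"
  proof -
    have "norm (exp u) \<le> c" 
      unfolding c_def by (rule order_trans[OF norm_exp]) (simp add: u)
    then show ?thesis using c by (simp add: norm_divide)
  qed
  have 2: "norm ((1 + u) / of_real c) \<le> 1"
  proof -
    have "norm (1 + u) \<le> 1 + norm u" using norm_triangle_ineq[of 1 u] by simp
    also have "\<dots> \<le> exp (norm u)" by (rule exp_ge_add_one_self)
    also have "\<dots> \<le> c" using u unfolding c_def by simp
    finally show ?thesis using c by (simp add: norm_divide)
  qed
  have 3: "norm (1 + u - exp u) \<le> exp B * B\<^sup>2 / n\<^sup>2"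
  proof -
    have "norm (1 + u - exp u) \<le> exp (norm u) * (norm u)\<^sup>2"
      using Taylor_exp_field[of u 1] by (simp add: norm_minus_commute power2_eq_square algebra_simps)
    also have "\<dots> \<le> exp B * (B / n)\<^sup>2"
      using u by (intro mult_mono power_mono) auto
    finally show ?thesis by (simp add: power_divide)
  qed
  have "norm ((1 + u) ^ n - exp u ^ n) = exp B * norm (((1 + u) / of_real c) ^ n - (exp u / of_real c) ^ n)"
    using c cn by (simp add: power_divide flip: diff_divide_distrib) (simp add: norm_divide norm_power)
  also have "\<dots> \<le> exp B * (n * norm ((1 + u) / of_real c - exp u / of_real c))"
    by (intro mult_left_mono norm_power_diff 1 2) auto
  also have "\<dots> = exp B * (n * (norm (1 + u - exp u) / c))"
    using c by (simp flip: diff_divide_distrib) (simp add: norm_divide)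
  also have "\<dots> \<le> exp B * (n * (norm (1 + u - exp u) / 1))"
    using c by (intro mult_left_mono divide_left_mono) auto
  also have "\<dots> \<le> exp B * (n * (exp B * B\<^sup>2 / n\<^sup>2))"
    using 3 by (intro mult_left_mono) auto
  also have "\<dots> = exp (2 * B) * B\<^sup>2 / n"
    using assms by (simp add: power2_eq_square exp_double)
  finally show ?thesis
    using assms by (simp add: u_def flip: exp_of_nat_mult)
qed

text \<open>Through \<open>(1 + p/n)\<^sup>n\<close>; only large \<open>n\<close> matter, and \<open>1 + p/n\<close> may well vanish identically for
  a small \<open>n\<close> if \<open>p\<close> is constant.\<close>
lemma approximable_exp:
  assumes "eventually (\<lambda>n. at_most_nonreal 0 (1 + smult (1 / real n) p)) sequentially"
  shows "approximable 0 (\<lambda>z. exp (cpoly p z))"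
  unfolding approximable_def
proof (intro allI impI)
  fix R \<epsilon> :: real assume "\<epsilon> > 0"
  have "compact (cpoly p ` cball 0 R)"
    by (intro compact_continuous_image continuous_intros) auto
  then obtain B where B: "\<And>z. norm z \<le> R \<Longrightarrow> norm (cpoly p z) \<le> B"
    using compact_imp_bounded[THEN bounded_pos[THEN iffD1]] by force
  have "(\<lambda>n. exp (2 * B) * B\<^sup>2 / real n) \<longlonglongrightarrow> 0"
    by (intro tendsto_divide_0[OF tendsto_const] filterlim_at_top_imp_at_infinity filterlim_real_sequentially)
  then have "eventually (\<lambda>n. exp (2 * B) * B\<^sup>2 / real n < \<epsilon>) sequentially"
    using \<open>\<epsilon> > 0\<close> by (rule order_tendstoD)
  from eventually_happens'[OF sequentially_bot
      eventually_conj[OF this eventually_conj[OF assms eventually_gt_at_top[of 0]]]]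
  obtain n where n: "exp (2 * B) * B\<^sup>2 / real n < \<epsilon>"
    "at_most_nonreal 0 (1 + smult (1 / real n) p)" "n > 0" by blast
  let ?P = "(1 + smult (1 / real n) p) ^ n"
  have "cpoly (1 + smult (1 / real n) p) z = 1 + cpoly p z / of_nat n" for z
  proof -
    have "map_poly complex_of_real (1 + smult (1 / real n) p)
        = 1 + smult (1 / of_nat n) (map_poly complex_of_real p)"
      by (rule poly_eqI) (simp add: coeff_map_poly)
    then show ?thesis by simp
  qed
  then have "cpoly ?P z = (1 + cpoly p z / of_nat n) ^ n" for z
    by (simp add: map_poly_of_real_power)
  then have "norm (cpoly ?P z - exp (cpoly p z)) < \<epsilon>" if "norm z \<le> R" for z
    using norm_exp_minus_power_le[OF B[OF that] n(3)] n(1) by simp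
  with at_most_nonreal_power[OF n(2)]
  show "\<exists>P. at_most_nonreal 0 P \<and> (\<forall>z. norm z \<le> R \<longrightarrow> norm (cpoly P z - exp (cpoly p z)) < \<epsilon>)"
    by blast
qed

lemma approximable_exp_linear:
  assumes "degree q \<le> 1"
  shows "approximable 0 (\<lambda>z. exp (cpoly q z))"
proof (rule approximable_exp)
  have "eventually (\<lambda>n::nat. real n > \<bar>coeff q 0\<bar>) sequentially"
    using filterlim_real_sequentially by (auto simp: filterlim_at_top_dense)
  then show "eventually (\<lambda>n. at_most_nonreal 0 (1 + smult (1 / real n) q)) sequentially"
  proof eventually_elim
    case (elim n)
    show ?case
    proof (rule at_most_nonreal_linear)
      show "degree (1 + smult (1 / real n) q) \<le> 1"
        using assms by (intro degree_add_le) (auto intro: order_trans[OF degree_smult_le])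
      show "1 + smult (1 / real n) q \<noteq> 0"
      proof
        assume "1 + smult (1 / real n) q = 0"
        then have "coeff (1 + smult (1 / real n) q) 0 = 0" by simp
        then show False using elim by (auto simp: field_simps split: if_splits)
      qed
    qed
  qed
qed

text \<open>Here the sign of \<open>\<gamma>\<close> enters: \<open>1 - \<gamma> z\<^sup>2 / n\<close> splits into real linear factors exactly when
  \<open>\<gamma> \<ge> 0\<close>.\<close>
lemma approximable_exp_quadratic:
  assumes "\<gamma> \<ge> 0"
  shows "approximable 0 (\<lambda>z. exp (- of_real \<gamma> * z\<^sup>2))"
proof -
  have "approximable 0 (\<lambda>z. exp (cpoly [:0, 0, - \<gamma>:] z))"
  proof (intro approximable_exp always_eventually allI)
    fix n :: nat
    define s where "s = sqrt (\<gamma> / n)"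
    have s: "s * s = \<gamma> / n" using assms by (simp add: s_def)
    have eq: "1 + smult (1 / real n) [:0, 0, - \<gamma>:] = [:1, s:] * [:1, - s:]"
      using s by (simp add: one_pCons)
    show "at_most_nonreal 0 (1 + smult (1 / real n) [:0, 0, - \<gamma>:])"
      unfolding eq using at_most_nonreal_mult[OF at_most_nonreal_linear at_most_nonreal_linear, of "[:1, s:]" "[:1, -s:]"]
      by simp
  qed
  then show ?thesis by (simp add: map_poly_pCons power2_eq_square algebra_simps)
qed

lemma deriv_cpoly: "deriv (cpoly P) = cpoly (pderiv P)"
  by (rule ext) (auto simp: map_poly_of_real_pderiv intro!: DERIV_imp_deriv poly_DERIV)

lemma approximable_holomorphic:
  assumes "approximable m f"
  shows "f holomorphic_on A"
proof -
  have "\<exists>P. \<forall>w. norm w \<le> norm z + 1 \<longrightarrow> norm (cpoly P w - f w) < 1 / real (Suc n)" for z :: complex and n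
    using approximableE[OF assms, of "1 / real (Suc n)" "norm z + 1"] by auto
  then obtain P where P: "\<And>(z::complex) n w. norm w \<le> norm z + 1 \<Longrightarrow> norm (cpoly (P z n) w - f w) < 1 / real (Suc n)"
    by metis
  have "f holomorphic_on ball z 1" for z
  proof (rule holomorphic_uniform_limit[where f = "\<lambda>n. cpoly (P z n)" and F = sequentially and g = f and z = z and r = 1])
    show "\<forall>\<^sub>F n in sequentially. continuous_on (cball z 1) (cpoly (P z n)) \<and> cpoly (P z n) holomorphic_on ball z 1"
      by (intro always_eventually allI conjI continuous_intros holomorphic_intros)
    show "uniform_limit (cball z 1) (\<lambda>n. cpoly (P z n)) f sequentially"
    proof (rule uniform_limitI)
      fix e :: real assume "e > 0"
      then obtain N where N: "1 / real (Suc N) < e" by (rule nat_approx_posE)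
      show "\<forall>\<^sub>F n in sequentially. \<forall>x\<in>cball z 1. dist (cpoly (P z n) x) (f x) < e"
      proof (rule eventually_sequentiallyI[of N], intro ballI)
        fix n x assume "N \<le> n" "x \<in> cball z 1"
        then have "norm x \<le> norm z + 1"
          using norm_triangle_ineq2[of x z] by (simp add: dist_norm norm_minus_commute)
        then have "dist (cpoly (P z n) x) (f x) < 1 / real (Suc n)" using P by (simp add: dist_norm)
        also have "\<dots> \<le> 1 / real (Suc N)" using \<open>N \<le> n\<close> by (simp add: field_simps)
        finally show "dist (cpoly (P z n) x) (f x) < e" using N by simp
      qed
    qed
  qed auto
  then have "f analytic_on UNIV" unfolding analytic_on_def by (metis zero_less_one)
  then show ?thesis
    using analytic_imp_holomorphic holomorphic_on_subset by blast
qed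

text \<open>By Cauchy's inequality on unit circles, a polynomial close to \<open>f\<close> on the disc of radius
  \<open>R + 1\<close> has its derivatives close to those of \<open>f\<close> on the disc of radius \<open>R\<close>; the factor
  \<open>1/3\<close> absorbs the constant \<open>2!\<close> of the second derivative.\<close>
lemma approximable_derivs:
  assumes "approximable m f" "\<epsilon> > 0"
  obtains P where "at_most_nonreal m P"
    "\<And>z. norm z \<le> R \<Longrightarrow> norm (cpoly P z - f z) < \<epsilon>"
    "\<And>z. norm z \<le> R \<Longrightarrow> norm (cpoly (pderiv P) z - deriv f z) < \<epsilon>"
    "\<And>z. norm z \<le> R \<Longrightarrow> norm (cpoly (pderiv (pderiv P)) z - deriv (deriv f) z) < \<epsilon>"
proof -
  obtain P where P: "at_most_nonreal m P"
     "\<And>z. norm z \<le> R + 1 \<Longrightarrow> norm (cpoly P z - f z) < \<epsilon> / 3"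
    using approximableE[OF assms(1), of "\<epsilon> / 3" "R + 1"] assms(2) by auto
  define h where "h = (\<lambda>z. cpoly P z - f z)"
  note f = approximable_holomorphic[OF assms(1)]
  have h: "h holomorphic_on A" for A
    unfolding h_def by (intro holomorphic_intros f)
  have C: "norm ((deriv ^^ n) h z) \<le> fact n * (\<epsilon> / 3) / 1 ^ n" if "norm z \<le> R" for z n
  proof (rule Cauchy_inequality)
    show "norm (h x) \<le> \<epsilon> / 3" if "norm (z - x) = 1" for x
      using P(2)[of x] norm_triangle_ineq2[of x z] that \<open>norm z \<le> R\<close>
      by (simp add: h_def norm_minus_commute)
  qed (use h holomorphic_on_imp_continuous_on in auto)
  have fd: "f field_differentiable at z" "deriv f field_differentiable at z" for z
    using f holomorphic_deriv[OF f, of UNIV] by (auto simp: holomorphic_on_def)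
  have pd: "cpoly P field_differentiable at z" for P z
    using poly_holomorphic_on[of "\<lambda>z. z" UNIV] by (auto simp: holomorphic_on_def)
  have h1: "deriv h = (\<lambda>z. cpoly (pderiv P) z - deriv f z)"
    unfolding h_def by (rule ext) (simp add: deriv_diff fd pd flip: deriv_cpoly)
  have h2: "deriv (deriv h) = (\<lambda>z. cpoly (pderiv (pderiv P)) z - deriv (deriv f) z)"
    unfolding h1 by (rule ext) (simp add: deriv_diff fd pd deriv_cpoly)
  show thesis
  proof
    show "norm (cpoly P z - f z) < \<epsilon>" if "norm z \<le> R" for z
      using P(2)[of z] that assms(2) by simp
    show "norm (cpoly (pderiv P) z - deriv f z) < \<epsilon>" if "norm z \<le> R" for z
      using C[of z 1] that assms(2) by (simp add: h1)
    show "norm (cpoly (pderiv (pderiv P)) z - deriv (deriv f) z) < \<epsilon>" if "norm z \<le> R" for z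
      using C[of z 2] that assms(2) by (simp add: h2 numeral_2_eq_2)
  qed (rule P(1))
qed

text \<open>Evaluation at a real point: polynomial inequalities between the value and the first two
  derivatives carry over to \<open>f\<close>.\<close>
lemma approximable_real_jet:
  assumes "approximable m f"
  obtains P where "\<And>n. at_most_nonreal m (P n)"
    "(\<lambda>n. poly (P n) x) \<longlonglongrightarrow> Re (f (of_real x))"
    "(\<lambda>n. poly (pderiv (P n)) x) \<longlonglongrightarrow> Re (deriv f (of_real x))"
    "(\<lambda>n. poly (pderiv (pderiv (P n))) x) \<longlonglongrightarrow> Re (deriv (deriv f) (of_real x))"
    "f (of_real x) \<in> \<real>" "deriv f (of_real x) \<in> \<real>" "deriv (deriv f) (of_real x) \<in> \<real>"
proof -
  have "\<exists>P. at_most_nonreal m P \<and> norm (cpoly P (of_real x) - f (of_real x)) < 1 / real (Suc n) \<and>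
     norm (cpoly (pderiv P) (of_real x) - deriv f (of_real x)) < 1 / real (Suc n) \<and>
     norm (cpoly (pderiv (pderiv P)) (of_real x) - deriv (deriv f) (of_real x)) < 1 / real (Suc n)" for n
    by (rule approximable_derivs[OF assms, of "1 / real (Suc n)" "norm (of_real x :: complex)"]) (simp, blast)
  then obtain P where P: "\<And>n. at_most_nonreal m (P n)"
     "\<And>n. norm (cpoly (P n) (of_real x) - f (of_real x)) < 1 / real (Suc n)"
     "\<And>n. norm (cpoly (pderiv (P n)) (of_real x) - deriv f (of_real x)) < 1 / real (Suc n)"
     "\<And>n. norm (cpoly (pderiv (pderiv (P n))) (of_real x) - deriv (deriv f) (of_real x)) < 1 / real (Suc n)"
    by metis
  have lim: "(\<lambda>n. a n) \<longlonglongrightarrow> Re b \<and> b \<in> \<real>" if "\<And>n. norm (of_real (a n) - b) < 1 / real (Suc n)" for a :: "nat \<Rightarrow> real" and b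
  proof -
    have "(\<lambda>n. of_real (a n) - b) \<longlonglongrightarrow> 0"
      by (rule Lim_null_comparison[OF _ LIMSEQ_inverse_real_of_nat])
        (use that in \<open>auto simp: inverse_eq_divide less_imp_le\<close>)
    then have "(\<lambda>n. of_real (a n)) \<longlonglongrightarrow> b" by (rule LIM_zero_cancel)
    from tendsto_Re[OF this] tendsto_Im[OF this] show ?thesis
      by (simp add: complex_is_Real_iff LIMSEQ_const_iff)
  qed
  show thesis
    using that[of P] P lim[of "\<lambda>n. poly (P n) x" "f (of_real x)"]
      lim[of "\<lambda>n. poly (pderiv (P n)) x" "deriv f (of_real x)"]
      lim[of "\<lambda>n. poly (pderiv (pderiv (P n))) x" "deriv (deriv f) (of_real x)"]
    by simp
qed

lemma approximable_real_on_reals: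
  assumes "approximable m h"
  shows "h (of_real x) \<in> \<real>" "deriv h (of_real x) \<in> \<real>" "deriv (deriv h) (of_real x) \<in> \<real>"
  using approximable_real_jet[OF assms, of x] by metis+

text \<open>Induction on the linear factors: for \<open>P = (x - a) Q\<close>, the expression \<open>P'\<^sup>2 - P P''\<close> is
  \<open>(x - a)\<^sup>2 (Q'\<^sup>2 - Q Q'') + Q\<^sup>2\<close>.\<close>
lemma poly_Laguerre_inequality:
  assumes "at_most_nonreal 0 P"
  shows "poly P x * poly (pderiv (pderiv P)) x \<le> (poly (pderiv P) x)\<^sup>2"
  using assms
proof (induction "degree P" arbitrary: P)
  case 0
  then obtain c where "P = [:c:]" by (metis degree_eq_zeroE)
  then show ?case by (simp add: pderiv_pCons)
next
  case (Suc n)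
  then have "size (proots P) \<noteq> 0" "P \<noteq> 0" by (auto simp: at_most_nonreal_def)
  then obtain a where "a \<in># proots P" by (cases "proots P") auto
  then have "poly P a = 0" using \<open>P \<noteq> 0\<close> by simp
  then obtain Q where P: "P = [:-a, 1:] * Q" by (auto simp: poly_eq_0_iff_dvd)
  have "Q \<noteq> 0" using P \<open>P \<noteq> 0\<close> by auto
  have deg: "degree P = Suc (degree Q)" unfolding P using \<open>Q \<noteq> 0\<close> by (subst degree_mult_eq) auto
  have "proots P = {#a#} + proots Q"
    unfolding P using \<open>Q \<noteq> 0\<close> by (subst proots_mult) auto
  then have "at_most_nonreal 0 Q"
    using Suc.prems deg \<open>Q \<noteq> 0\<close> by (auto simp: at_most_nonreal_def)
  then have "poly Q x * poly (pderiv (pderiv Q)) x \<le> (poly (pderiv Q) x)\<^sup>2"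
    using Suc deg by simp
  then have "0 \<le> (x - a)\<^sup>2 * ((poly (pderiv Q) x)\<^sup>2 - poly Q x * poly (pderiv (pderiv Q)) x) + (poly Q x)\<^sup>2"
    by (intro add_nonneg_nonneg mult_nonneg_nonneg) auto
  also have "\<dots> = (poly (pderiv P) x)\<^sup>2 - poly P x * poly (pderiv (pderiv P)) x"
  proof -
    define A where "A = [:- a, 1:]"
    have "pderiv A = 1" by (simp add: A_def pderiv_pCons one_pCons)
    then have "poly (pderiv P) x = (x - a) * poly (pderiv Q) x + poly Q x"
      "poly (pderiv (pderiv P)) x = (x - a) * poly (pderiv (pderiv Q)) x + 2 * poly (pderiv Q) x"
      "poly P x = (x - a) * poly Q x"
      unfolding P A_def [symmetric] by (simp_all add: pderiv_mult pderiv_add)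
        (simp_all add: A_def algebra_simps)
    then show ?thesis by (simp only:) (simp add: power2_eq_square algebra_simps)
  qed
  finally show ?case by simp
qed

lemma Laguerre_inequality:
  assumes "approximable 0 f"
  shows "Re (f (of_real x)) * Re (deriv (deriv f) (of_real x)) \<le> (Re (deriv f (of_real x)))\<^sup>2"
proof -
  obtain P where P: "\<And>n. at_most_nonreal 0 (P n)"
    "(\<lambda>n. poly (P n) x) \<longlonglongrightarrow> Re (f (of_real x))"
    "(\<lambda>n. poly (pderiv (P n)) x) \<longlonglongrightarrow> Re (deriv f (of_real x))"
    "(\<lambda>n. poly (pderiv (pderiv (P n))) x) \<longlonglongrightarrow> Re (deriv (deriv f) (of_real x))"
    using approximable_real_jet[OF assms] by metis
  show ?thesis
    by (rule tendsto_le[OF sequentially_bot tendsto_power[OF P(3)] tendsto_mult[OF P(2,4)]])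
      (simp add: poly_Laguerre_inequality[OF P(1)])
qed

lemma approximable_1: "approximable 0 (\<lambda>_. 1)"
  using approximable_cpoly[of 0 1] by (simp add: at_most_nonreal_def poly_1 [abs_def])

lemma approximable_0_mult:
  "approximable 0 f \<Longrightarrow> approximable 0 g \<Longrightarrow> approximable 0 (\<lambda>z. f z * g z)"
  using approximable_mult[of 0 f 0 g] by simp

section \<open>The Laguerre--Polya class consists of limits of real-rooted polynomials\<close>

lemma weierstrass_factor_approximable:
  assumes "l \<le> 1" "enat j < \<omega> \<Longrightarrow> \<alpha> j \<noteq> 0"
  shows "approximable 0 (weierstrass_factor \<omega> l \<alpha> j)"
proof -
  consider "\<not> enat j < \<omega>" | "enat j < \<omega>" "l = 0" | "enat j < \<omega>" "l = 1" using assms by linarith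
  then show ?thesis
  proof cases
    case 1
    then have "weierstrass_factor \<omega> l \<alpha> j = (\<lambda>_. 1)"
      by (auto simp: weierstrass_factor_def)
    then show ?thesis by (simp add: approximable_1)
  next
    case 2
    have "approximable 0 (cpoly [:1, - 1 / \<alpha> j:])"
      by (intro approximable_cpoly at_most_nonreal_linear) auto
    moreover have "weierstrass_factor \<omega> l \<alpha> j = cpoly [:1, - 1 / \<alpha> j:]"
      using 2 by (auto simp: weierstrass_factor_def map_poly_pCons)
    ultimately show ?thesis by simp
  next
    case 3
    have "approximable (0 + 0) (\<lambda>z. cpoly [:1, - 1 / \<alpha> j:] z * exp (cpoly [:0, 1 / \<alpha> j:] z))"
      by (intro approximable_mult approximable_cpoly at_most_nonreal_linear approximable_exp_linear) auto
    moreover have "weierstrass_factor \<omega> l \<alpha> j = (\<lambda>z. cpoly [:1, - 1 / \<alpha> j:] z * exp (cpoly [:0, 1 / \<alpha> j:] z))"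
      using 3 by (auto simp: weierstrass_factor_def map_poly_pCons)
    ultimately show ?thesis by simp
  qed
qed

context
  fixes \<omega> :: enat and l :: nat and \<alpha> :: "nat \<Rightarrow> real"
  assumes l: "l \<le> 1" and nz: "\<And>j. enat j < \<omega> \<Longrightarrow> \<alpha> j \<noteq> 0"
    and summ: "summable (\<lambda>j. if enat j < \<omega> then 1 / \<bar>\<alpha> j\<bar> ^ (l + 1) else 0)"
begin

text \<open>A summable majorant. The terms of the given series tend to 0, so eventually \<open>\<bar>\<alpha> j\<bar> > 2 R\<close>,
  and then the standard estimate for Weierstrass factors on the disc of radius \<open>1/2\<close> applies to
  \<open>z / \<alpha> j\<close>.\<close>
lemma weierstrass_factor_minus_1_bound:
  assumes "R > 0"
  shows "\<forall>\<^sub>F j in sequentially. \<forall>z\<in>cball 0 R.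
     norm (norm (weierstrass_factor \<omega> l \<alpha> j z - 1))
       \<le> 3 * R ^ (l + 1) * (if enat j < \<omega> then 1 / \<bar>\<alpha> j\<bar> ^ (l + 1) else 0)"
proof -
  have "\<forall>\<^sub>F j in sequentially. (if enat j < \<omega> then 1 / \<bar>\<alpha> j\<bar> ^ (l + 1) else 0) < (1 / (2 * R)) ^ (l + 1)"
    using summable_LIMSEQ_zero[OF summ] assms by (intro order_tendstoD) auto
  then show ?thesis
  proof eventually_elim
    case (elim j)
    show ?case
    proof (intro ballI)
      fix z :: complex assume z: "z \<in> cball 0 R"
      show "norm (norm (weierstrass_factor \<omega> l \<alpha> j z - 1))
         \<le> 3 * R ^ (l + 1) * (if enat j < \<omega> then 1 / \<bar>\<alpha> j\<bar> ^ (l + 1) else 0)"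
      proof (cases "enat j < \<omega>")
        case True
        let ?w = "z / of_real (\<alpha> j)"
        have "(1 / \<bar>\<alpha> j\<bar>) ^ (l + 1) < (1 / (2 * R)) ^ (l + 1)"
          using elim True by (simp add: power_one_over)
        then have "1 / \<bar>\<alpha> j\<bar> < 1 / (2 * R)"
          by (rule power_less_imp_less_base) (use assms in simp)
        then have "norm z * (1 / \<bar>\<alpha> j\<bar>) \<le> R * (1 / (2 * R))"
          using z assms by (intro mult_mono) auto
        then have "norm ?w \<le> 1 / 2" using assms by (simp add: norm_divide)
        then have "norm (Weierstrass_Factorization.weierstrass_factor l ?w - 1) \<le> 3 * norm ?w ^ Suc l"
          by (rule weierstrass_factor_bound)
        also have "\<dots> \<le> 3 * (R / \<bar>\<alpha> j\<bar>) ^ Suc l"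
          using z by (intro mult_left_mono power_mono) (auto simp: norm_divide intro!: divide_right_mono)
        also have "Weierstrass_Factorization.weierstrass_factor l ?w = weierstrass_factor \<omega> l \<alpha> j z"
          using True by (simp add: Weierstrass_Factorization.weierstrass_factor_def
              weierstrass_factor_def power_divide mult.commute)
        finally show ?thesis using True by (simp add: power_divide)
      qed (simp add: weierstrass_factor_def)
    qed
  qed
qed

lemma convergent_prod_weierstrass_factor:
  "convergent_prod (\<lambda>j. weierstrass_factor \<omega> l \<alpha> j z)"
proof -
  have "summable (\<lambda>j. norm (weierstrass_factor \<omega> l \<alpha> j z - 1))"
  proof (rule summable_comparison_test_ev)
    show "\<forall>\<^sub>F j in sequentially. norm (norm (weierstrass_factor \<omega> l \<alpha> j z - 1))
       \<le> 3 * (norm z + 1) ^ (l + 1) * (if enat j < \<omega> then 1 / \<bar>\<alpha> j\<bar> ^ (l + 1) else 0)"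
      by (rule eventually_mono[OF weierstrass_factor_minus_1_bound[of "norm z + 1"]])
        (simp_all add: add_nonneg_pos)
  qed (intro summable_mult summ)
  then show ?thesis
    by (simp add: abs_convergent_prod_conv_summable abs_convergent_prod_imp_convergent_prod)
qed

lemma approximable_weierstrass_product:
  "approximable 0 (\<lambda>z. \<Prod>j. weierstrass_factor \<omega> l \<alpha> j z)"
proof (rule approximable_uniform_limit)
  let ?w = "weierstrass_factor \<omega> l \<alpha>"
  have wf: "approximable 0 (?w j)" for j
    using l nz by (rule weierstrass_factor_approximable)
  show "approximable 0 (\<lambda>z. \<Prod>j<N. ?w j z)" for N
  proof (induction N)
    case 0
    show ?case by (simp add: approximable_1)
  next
    case (Suc N)
    then show ?case using approximable_mult[OF Suc wf[of N]] by simp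
  qed
  fix R :: real
  define S where "S = max R 1"
  have "uniformly_convergent_on (cball 0 S) (\<lambda>N z. \<Prod>j<N. ?w j z)"
  proof (rule uniformly_convergent_on_prod')
    show "continuous_on (cball 0 S) (?w j)" for j
      by (rule holomorphic_on_imp_continuous_on approximable_holomorphic wf)+
    show "uniformly_convergent_on (cball 0 S) (\<lambda>N z. \<Sum>n<N. norm (?w n z - 1))"
      by (rule Weierstrass_m_test'_ev[OF weierstrass_factor_minus_1_bound])
        (auto simp: S_def intro!: summable_mult summ)
  qed auto
  then obtain g where g: "uniform_limit (cball 0 S) (\<lambda>N z. \<Prod>j<N. ?w j z) g sequentially"
    by (auto simp: uniformly_convergent_on_def)
  have "g z = (\<Prod>j. ?w j z)" if "z \<in> cball 0 S" for z
  proof -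
    have "(\<lambda>N. \<Prod>j<Suc N. ?w j z) \<longlonglongrightarrow> g z"
      using tendsto_uniform_limitI[OF g that] by (rule LIMSEQ_Suc)
    moreover have "(\<lambda>N. \<Prod>j<Suc N. ?w j z) \<longlonglongrightarrow> (\<Prod>j. ?w j z)"
      using convergent_prod_LIMSEQ[OF convergent_prod_weierstrass_factor[of z]]
      by (simp only: lessThan_Suc_atMost)
    ultimately show ?thesis by (rule LIMSEQ_unique)
  qed
  then have "uniform_limit (cball 0 S) (\<lambda>N z. \<Prod>j<N. ?w j z) (\<lambda>z. \<Prod>j. ?w j z) sequentially"
    using g by (subst uniform_limit_cong'[where g = "\<lambda>N z. \<Prod>j<N. ?w j z" and i = g]) auto
  then show "uniform_limit (cball 0 R) (\<lambda>N z. \<Prod>j<N. ?w j z) (\<lambda>z. \<Prod>j. ?w j z) sequentially"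
    by (rule uniform_limit_on_subset) (auto simp: S_def)
qed

text \<open>A convergent product vanishes only if a factor does, and the only zero that a factor can have is the
  real number \<open>\<alpha> j\<close>.\<close>
lemma weierstrass_product_nonzero:
  assumes "z \<notin> \<real>"
  shows "(\<Prod>j. weierstrass_factor \<omega> l \<alpha> j z) \<noteq> 0"
proof (rule prodinf_nonzero[OF convergent_prod_weierstrass_factor])
  show "weierstrass_factor \<omega> l \<alpha> j z \<noteq> 0" for j
    using assms nz[of j] by (auto simp: weierstrass_factor_def field_simps)
qed

end

lemma laguerre_polya_approximable_nonzero:
  assumes "f \<in> laguerre_polya"
  shows "approximable 0 f" and "z \<notin> \<real> \<Longrightarrow> f z \<noteq> 0"
proof -
  obtain c d \<gamma> q l \<omega> \<alpha> where c: "c \<noteq> 0" and "\<gamma> \<ge> 0" and q: "degree q \<le> 1" and l: "l \<le> 1"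
    and nz: "\<And>j. enat j < \<omega> \<Longrightarrow> \<alpha> j \<noteq> 0"
    and summ: "summable (\<lambda>j. if enat j < \<omega> then 1 / \<bar>\<alpha> j\<bar> ^ (l + 1) else 0)"
    and f: "\<And>z. f z = of_real c * z ^ d * exp (- of_real \<gamma> * z ^ 2 + cpoly q z) *
                (\<Prod>j. weierstrass_factor \<omega> l \<alpha> j z)"
    using assms unfolding laguerre_polya_def by blast
  have "at_most_nonreal 0 ([:c:] * [:0, 1:] ^ d)"
    using at_most_nonreal_mult[of 0 "[:c:]" 0 "[:0, 1:] ^ d", OF at_most_nonreal_linear
        at_most_nonreal_power[OF at_most_nonreal_linear]] c by simp
  then have "approximable 0 (\<lambda>z. cpoly ([:c:] * [:0, 1:] ^ d) z *
      (exp (- of_real \<gamma> * z\<^sup>2) * exp (cpoly q z)) * (\<Prod>j. weierstrass_factor \<omega> l \<alpha> j z))"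
    by (intro approximable_0_mult approximable_exp_quadratic approximable_exp_linear
        approximable_cpoly approximable_weierstrass_product[OF l nz summ] q \<open>\<gamma> \<ge> 0\<close>)
  also have "(\<lambda>z. cpoly ([:c:] * [:0, 1:] ^ d) z *
      (exp (- of_real \<gamma> * z\<^sup>2) * exp (cpoly q z)) * (\<Prod>j. weierstrass_factor \<omega> l \<alpha> j z)) = f"
    by (rule ext) (simp add: f map_poly_of_real_mult map_poly_of_real_power map_poly_pCons
        del: mult_pCons_left flip: exp_add)
  finally show "approximable 0 f" .
  show "f z \<noteq> 0" if "z \<notin> \<real>"
    using that c weierstrass_product_nonzero[OF l nz summ that] by (auto simp: f)
qed

section \<open>Nonreal zeros of the derivative\<close>

lemma zorder_poly:
  assumes "p \<noteq> 0"
  shows "zorder (poly p) z = int (order z (p :: complex poly))"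
proof -
  obtain n where n: "order z p = n" by blast
  obtain q where p: "p = [:-z, 1:] ^ n * q" and q: "poly q z \<noteq> 0"
    using order_decomp[OF assms, of z] unfolding n by (auto simp: poly_eq_0_iff_dvd)
  have "zorder (poly p) z = int n"
  proof (rule zorder_eqI)
    show "poly p w = poly q w * (w - z) powi int n" for w
      unfolding p by (simp add: power_int_def)
    show "poly q holomorphic_on UNIV"
      by (intro holomorphic_intros)
  qed (use q in auto)
  then show ?thesis by (simp add: n)
qed

lemma entire_eventually_nonzero:
  assumes "h holomorphic_on UNIV" "h w \<noteq> 0"
  shows "\<forall>\<^sub>F z in at a. h z \<noteq> (0 :: complex)"
  using non_zero_neighbour_alt[OF assms(1), of a w] assms(2)
  by (auto elim: eventually_mono)

lemma entire_analytic: "h holomorphic_on UNIV \<Longrightarrow> h analytic_on A"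
  by (rule analytic_on_subset[of _ UNIV]) (simp_all add: analytic_on_open)

text \<open>A local form of Hurwitz's theorem: near an isolated zero of \<open>g\<close>, a function close to \<open>g\<close> has
  as many zeros as the multiplicity of that zero.\<close>
lemma Rouche_single_zero:
  assumes g: "g holomorphic_on UNIV" and h: "h holomorphic_on UNIV"
    and r: "r > 0" and zero: "\<And>w. w \<in> ball a (2 * r) \<Longrightarrow> g w = 0 \<longleftrightarrow> w = a"
    and fin: "finite {w. h w = 0}"
    and close: "\<And>w. w \<in> sphere a r \<Longrightarrow> norm (h w - g w) < norm (g w)"
  shows "(\<Sum>w\<in>{w\<in>ball a r. h w = 0}. zorder h w) = zorder g a"
proof -
  let ?\<gamma> = "circlepath a r" and ?s = "ball a (2 * r)"
  have winding: "winding_number ?\<gamma> w = (if w \<in> ball a r then 1 else 0)" if "w \<notin> sphere a r" for w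
  proof (cases "w \<in> ball a r")
    case True
    then have "norm (w - a) < r" by (simp add: dist_norm norm_minus_commute)
    from winding_number_circlepath[OF this] True show ?thesis by simp
  next
    case False
    then have "w \<notin> cball a r" using that by auto
    then have "winding_number ?\<gamma> w = 0"
      by (intro winding_number_zero_outside[of _ "cball a r"]) (use r in auto)
    then show ?thesis using False by simp
  qed
  have "(\<Sum>p\<in>{p\<in>?s. g p + (h p - g p) = 0}. winding_number ?\<gamma> p * zorder (\<lambda>p. g p + (h p - g p)) p)
      = (\<Sum>p\<in>{p\<in>?s. g p = 0}. winding_number ?\<gamma> p * zorder g p)"
  proof (rule Rouche_theorem)
    show "finite {p \<in> ?s. g p + (h p - g p) = 0}" using fin by simp
    have "{p \<in> ?s. g p = 0} = {a}" using zero r by auto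
    then show "finite {p \<in> ?s. g p = 0}" by simp
    show "\<forall>z\<in>path_image ?\<gamma>. cmod (h z - g z) < cmod (g z)" using close r by simp
    show "\<forall>z. z \<notin> ?s \<longrightarrow> winding_number ?\<gamma> z = 0" using winding r by auto
    show "path_image ?\<gamma> \<subseteq> ?s" using r by auto
  qed (auto intro!: holomorphic_intros holomorphic_on_subset[OF g] holomorphic_on_subset[OF h])
  also have "{p\<in>?s. g p = 0} = {a}" using zero r by auto
  finally have "(\<Sum>p\<in>{p\<in>?s. h p = 0}. winding_number ?\<gamma> p * zorder h p) = zorder g a"
    using winding[of a] r by simp
  also have "(\<Sum>p\<in>{p\<in>?s. h p = 0}. winding_number ?\<gamma> p * zorder h p)
     = (\<Sum>p\<in>{w\<in>ball a r. h w = 0}. winding_number ?\<gamma> p * zorder h p)"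
  proof (rule sum.mono_neutral_right)
    have "p \<notin> sphere a r" if "h p = 0" for p
      using close[of p] that by auto
    then show "\<forall>p\<in>{p \<in> ?s. h p = 0} - {w \<in> ball a r. h w = 0}. winding_number ?\<gamma> p * zorder h p = 0"
      using winding by auto
  qed (use fin r in auto)
  also have "\<dots> = (\<Sum>p\<in>{w\<in>ball a r. h w = 0}. of_int (zorder h p))"
    using winding by (intro sum.cong) auto
  finally have "complex_of_int (\<Sum>p\<in>{w\<in>ball a r. h w = 0}. zorder h p) = of_int (zorder g a)"
    by simp
  then show ?thesis by (simp only: of_int_eq_iff)
qed

text \<open>The minimum of \<open>\<bar>g\<bar>\<close> is the accuracy with which \<open>g\<close> has to be approximated.\<close>
lemma norm_lower_bound_on_compact:
  fixes g :: "complex \<Rightarrow> complex"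
  assumes "compact K" "continuous_on K g" "\<And>z. z \<in> K \<Longrightarrow> g z \<noteq> 0"
  obtains \<delta> where "\<delta> > 0" "\<And>z. z \<in> K \<Longrightarrow> \<delta> \<le> norm (g z)"
proof (cases "K = {}")
  case True
  then show ?thesis using that[of 1] by auto
next
  case False
  then obtain a where "a \<in> K" "\<forall>z\<in>K. norm (g a) \<le> norm (g z)"
    using continuous_attains_inf[OF assms(1) False continuous_on_norm[OF assms(2)]] by blast
  then show ?thesis using that[of "norm (g a)"] assms(3) by auto
qed

text \<open>The witness is a finite set even if \<open>g\<close> has infinitely many nonreal zeros: then any \<open>m\<close> of
  them will do.\<close>
lemma Z_C_lower_bound_witness:
  assumes g: "g holomorphic_on UNIV" "g w \<noteq> 0" and le: "enat m \<le> Z_C g"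
  obtains T where "finite T" "T \<inter> \<real> = {}" "\<And>z. z \<in> T \<Longrightarrow> g z = 0"
    "m \<le> (\<Sum>z\<in>T. nat (zorder g z))"
proof -
  let ?S = "zeros g \<inter> - \<real>"
  have pos: "nat (zorder g z) \<ge> 1" if "z \<in> ?S" for z
    using that zorder_pos_iff[OF g(1) _ _ eventually_frequently[OF _ entire_eventually_nonzero[OF g]], of z]
    by (auto simp: zeros_def)
  show thesis
  proof (cases "finite ?S")
    case True
    then have "m \<le> (\<Sum>z\<in>?S. nat (zorder g z))"
      using le by (simp add: Z_C_def count_zeros_def)
    with True show thesis by (intro that[of ?S]) (simp_all add: zeros_def)
  next
    case False
    then obtain T where T: "T \<subseteq> ?S" "finite T" "card T = m"
      using infinite_arbitrarily_large[OF False, of m] by blast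
    have "m = (\<Sum>z\<in>T. 1)" using T by simp
    also have "\<dots> \<le> (\<Sum>z\<in>T. nat (zorder g z))"
      using T pos by (intro sum_mono) auto
    finally have "m \<le> (\<Sum>z\<in>T. nat (zorder g z))" .
    with T show thesis by (intro that[of T]) (auto simp: zeros_def)
  qed
qed

text \<open>Otherwise take nonreal zeros \<open>T\<close> of \<open>\<psi>'\<close> of total order at least \<open>m\<close>, and a polynomial \<open>P\<close>
  close to \<open>\<psi>\<close>. Its derivative has zeros of total order \<open>m\<close> near \<open>T\<close>, all nonreal, and at least
  two more zeros near \<open>x0\<close>. If one of the latter is nonreal, \<open>P'\<close> has more than \<open>m\<close> nonreal zeros,
  and so more than \<open>P\<close>. If all of them are real, they lie in an interval without zeros of \<open>P\<close>, so that
  \<open>P'\<close> has fewer nonreal zeros than \<open>P\<close>, that is, fewer than \<open>m\<close>.\<close>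
theorem nonreal_zeros_deriv_less:
  assumes \<psi>: "approximable m \<psi>" and w: "deriv \<psi> w \<noteq> 0"
    and x0: "\<psi> (of_real x0) \<noteq> 0" "deriv \<psi> (of_real x0) = 0" "deriv (deriv \<psi>) (of_real x0) = 0"
  shows "Z_C (deriv \<psi>) < enat m"
proof (rule ccontr)
  assume "\<not> Z_C (deriv \<psi>) < enat m"
  then have le: "enat m \<le> Z_C (deriv \<psi>)" by simp
  define g where "g = deriv \<psi>"
  have h\<psi>: "\<psi> holomorphic_on A" for A using approximable_holomorphic[OF \<psi>] .
  have hg: "g holomorphic_on A" for A
    unfolding g_def using holomorphic_deriv[OF h\<psi>[of UNIV]] holomorphic_on_subset by blast
  have gw: "g w \<noteq> 0" using w by (simp add: g_def)
  obtain T where T: "finite T" "T \<inter> \<real> = {}" "\<And>z. z \<in> T \<Longrightarrow> g z = 0"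
    "m \<le> (\<Sum>z\<in>T. nat (zorder g z))"
    using Z_C_lower_bound_witness[OF hg gw, of m] le by (auto simp: g_def)
  let ?c = "complex_of_real x0"
  have c: "?c \<notin> T" "g ?c = 0" using T x0 by (auto simp: g_def)
  define I where "I = insert ?c T"
  have I: "finite I" "\<And>z. z \<in> I \<Longrightarrow> g z = 0" using T c by (auto simp: I_def)
  have order2: "zorder g ?c \<ge> 2"
  proof -
    have "zorder g ?c \<ge> int 2"
    proof (rule zorder_geI[where A = UNIV])
      show "(deriv ^^ k) g ?c = 0" if "k < 2" for k
        using that x0 by (auto simp: less_2_cases_iff g_def)
    qed (use hg gw entire_analytic in auto)
    then show ?thesis by simp
  qed
  have "\<exists>r>0. \<forall>y\<in>ball z r. (y \<noteq> z \<longrightarrow> g y \<noteq> 0) \<and> (z \<in> T \<longrightarrow> y \<notin> \<real>) \<and> (z = ?c \<longrightarrow> \<psi> y \<noteq> 0)"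
    if "z \<in> I" for z
  proof -
    have 1: "\<forall>\<^sub>F y in nhds z. y \<noteq> z \<longrightarrow> g y \<noteq> 0"
      using entire_eventually_nonzero[OF hg gw, of z] by (simp add: eventually_at_filter)
    have 2: "\<forall>\<^sub>F y in nhds z. z \<in> T \<longrightarrow> y \<notin> \<real>"
    proof (cases "z \<in> T")
      case True
      then have "z \<in> - \<real>" using T by auto
      moreover have "open (- \<real> :: complex set)" by (simp add: closed_complex_Reals open_Compl)
      ultimately have "\<forall>\<^sub>F y in nhds z. y \<in> - \<real>" by (metis eventually_nhds_in_open)
      then show ?thesis by (auto elim: eventually_mono)
    qed simp
    have 3: "\<forall>\<^sub>F y in nhds z. z = ?c \<longrightarrow> \<psi> y \<noteq> 0"
    proof (cases "z = ?c")
      case True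
      have "open {y. \<psi> y \<noteq> 0}"
        by (intro open_Collect_neq holomorphic_on_imp_continuous_on h\<psi> continuous_on_const)
      then have "\<forall>\<^sub>F y in nhds z. y \<in> {y. \<psi> y \<noteq> 0}"
        using x0(1) True by (intro eventually_nhds_in_open) auto
      then show ?thesis by (auto elim: eventually_mono)
    qed simp
    from eventually_conj[OF 1 eventually_conj[OF 2 3]] show ?thesis
      by (auto simp: eventually_nhds_metric dist_commute)
  qed
  then obtain r where r': "\<forall>z\<in>I. r z > 0 \<and> (\<forall>y\<in>ball z (r z). (y \<noteq> z \<longrightarrow> g y \<noteq> 0) \<and>
      (z \<in> T \<longrightarrow> y \<notin> \<real>) \<and> (z = ?c \<longrightarrow> \<psi> y \<noteq> 0))"
    using bchoice[of I] by metis
  have r: "\<And>z. z \<in> I \<Longrightarrow> r z > 0"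
    "\<And>z y. z \<in> I \<Longrightarrow> y \<in> ball z (r z) \<Longrightarrow> y \<noteq> z \<Longrightarrow> g y \<noteq> 0"
    "\<And>z y. z \<in> T \<Longrightarrow> y \<in> ball z (r z) \<Longrightarrow> y \<notin> \<real>"
    "\<And>y. y \<in> ball ?c (r ?c) \<Longrightarrow> \<psi> y \<noteq> 0"
    using r' by (auto simp: I_def)
  \<comment> \<open>The factor 2 leaves room between the circle of radius \<open>\<rho>\<close> and the next zero, and it makes the discs disjoint.\<close>
  define \<rho> where "\<rho> = Min (r ` I) / 2"
  have "I \<noteq> {}" by (simp add: I_def)
  then have \<rho>: "\<rho> > 0" and \<rho>_le: "\<And>z. z \<in> I \<Longrightarrow> 2 * \<rho> \<le> r z"
    using I(1) r(1) by (auto simp: \<rho>_def)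
  have zero: "g y = 0 \<longleftrightarrow> y = z" if "z \<in> I" "y \<in> ball z (2 * \<rho>)" for z y
    using r(2)[of z y] \<rho>_le[of z] I(2)[of z] that by auto
  have disj: "ball z \<rho> \<inter> ball z' \<rho> = {}" if "z \<in> I" "z' \<in> I" "z \<noteq> z'" for z z'
  proof (rule ccontr)
    assume "ball z \<rho> \<inter> ball z' \<rho> \<noteq> {}"
    then obtain y where "dist z y < \<rho>" "dist z' y < \<rho>" by auto
    then have "z' \<in> ball z (2 * \<rho>)"
      using dist_triangle_less_add[of z y \<rho> z' \<rho>] by (simp add: dist_commute)
    then show False using zero[OF that(1)] I(2)[OF that(2)] that(3) by auto
  qed
  define K where "K = (\<Union>z\<in>I. sphere z \<rho>)"
  have K: "compact K" using I(1) by (auto simp: K_def intro!: compact_UN)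
  have "g y \<noteq> 0" if "y \<in> K" for y
    using that zero \<rho> by (fastforce simp: K_def)
  then obtain \<delta> where \<delta>: "\<delta> > 0" "\<And>z. z \<in> K \<Longrightarrow> \<delta> \<le> norm (g z)"
    using norm_lower_bound_on_compact[OF K holomorphic_on_imp_continuous_on[OF hg]] by blast
  have "\<psi> y \<noteq> 0" if "y \<in> cball ?c \<rho>" for y
    using r(4)[of y] \<rho>_le[of ?c] \<rho> that by (auto simp: I_def)
  then obtain \<delta>' where \<delta>': "\<delta>' > 0" "\<And>z. z \<in> cball ?c \<rho> \<Longrightarrow> \<delta>' \<le> norm (\<psi> z)"
    using norm_lower_bound_on_compact[OF compact_cball holomorphic_on_imp_continuous_on[OF h\<psi>]] by blast
  have "bounded (K \<union> cball ?c \<rho>)" using K by (auto intro: compact_imp_bounded)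
  then obtain R where "\<forall>y\<in>K \<union> cball ?c \<rho>. norm y \<le> R"
    unfolding bounded_iff by (rule exE)
  then have R: "\<And>y. y \<in> K \<union> cball ?c \<rho> \<Longrightarrow> norm y \<le> R" by blast
  have \<epsilon>: "min \<delta> \<delta>' > 0" using \<delta> \<delta>' by simp
  obtain P where P: "at_most_nonreal m P"
    "\<And>z. norm z \<le> R \<Longrightarrow> norm (cpoly P z - \<psi> z) < min \<delta> \<delta>'"
    "\<And>z. norm z \<le> R \<Longrightarrow> norm (cpoly (pderiv P) z - g z) < min \<delta> \<delta>'"
    unfolding g_def by (rule approximable_derivs[OF \<psi> \<epsilon>, of R]) blast
  let ?D = "pderiv P" and ?C = "map_poly complex_of_real (pderiv P)"
  have close: "norm (poly ?C y - g y) < norm (g y)" if "y \<in> K" for y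
    using P(3)[of y] R[of y] \<delta>(2)[OF that] that by auto
  have D: "?D \<noteq> 0"
  proof
    assume "?D = 0"
    moreover have "?c + of_real \<rho> \<in> K" using \<rho> by (auto simp: K_def I_def dist_norm)
    ultimately show False using close[of "?c + of_real \<rho>"] by simp
  qed
  then have C: "?C \<noteq> 0" by (simp add: map_poly_of_real_eq_0_iff)
  define Z where "Z z = {y\<in>ball z \<rho>. poly ?C y = 0}" for z
  have finZ: "finite (Z z)" for z
    using poly_roots_finite[OF C] by (simp add: Z_def)
  have sumZ: "(\<Sum>y\<in>Z z. order y ?C) = nat (zorder g z)" if "z \<in> I" for z
  proof -
    have "(\<Sum>y\<in>Z z. zorder (poly ?C) y) = zorder g z"
      unfolding Z_def
      by (rule Rouche_single_zero[OF hg poly_holomorphic_on[OF holomorphic_on_ident] \<rho> zero[OF that] poly_roots_finite[OF C] close])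
        (use that in \<open>auto simp: K_def\<close>)
    then have "int (\<Sum>y\<in>Z z. order y ?C) = zorder g z"
      by (simp add: zorder_poly C)
    then show ?thesis by linarith
  qed
  have disjZ: "Z z \<inter> Z z' = {}" if "z \<in> I" "z' \<in> I" "z \<noteq> z'" for z z'
    using disj[OF that] unfolding Z_def by blast
  define A where "A = (\<Union>z\<in>T. Z z)"
  have A: "finite A" "A \<inter> \<real> = {}" "A \<inter> Z ?c = {}"
  proof -
    show "finite A" using T finZ by (auto simp: A_def)
    show "A \<inter> \<real> = {}"
    proof -
      have "y \<notin> \<real>" if "z \<in> T" "y \<in> Z z" for y z
        using r(3)[of z y] \<rho>_le[of z] \<rho> that by (auto simp: Z_def I_def)
      then show ?thesis by (auto simp: A_def)
    qed
    show "A \<inter> Z ?c = {}"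
      unfolding A_def using disjZ[of _ ?c] c by (auto simp: I_def)
  qed
  have sumA: "m \<le> (\<Sum>y\<in>A. order y ?C)"
  proof -
    have "(\<Sum>y\<in>A. order y ?C) = (\<Sum>z\<in>T. \<Sum>y\<in>Z z. order y ?C)"
      unfolding A_def
      by (rule sum.UNION_disjoint) (use T finZ disjZ in \<open>auto simp: I_def\<close>)
    also have "\<dots> = (\<Sum>z\<in>T. nat (zorder g z))"
      using sumZ by (intro sum.cong) (auto simp: I_def)
    finally show ?thesis using T(4) by simp
  qed
  have sumB: "(\<Sum>y\<in>Z ?c. order y ?C) \<ge> 2"
    using sumZ[of ?c] order2 by (simp add: I_def)
  have P0: "P \<noteq> 0" "degree P \<le> size (proots P) + m"
    using P(1) by (auto simp: at_most_nonreal_def)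
  have degD: "degree P = degree ?D + 1"
  proof -
    have "degree P \<noteq> 0" using D by (simp add: pderiv_eq_0_iff)
    then show ?thesis by (simp add: degree_pderiv)
  qed
  have free: "poly P x \<noteq> 0" if "x0 - \<rho> < x" "x < x0 + \<rho>" for x
  proof
    assume "poly P x = 0"
    moreover have "of_real x \<in> cball ?c \<rho>" using that by (auto simp: dist_of_real dist_real_def)
    ultimately show False using P(2)[of "of_real x"] R[of "of_real x"] \<delta>'(2)[of "of_real x"] by auto
  qed
  \<comment> \<open>The two cases: some zero of the approximating derivative near \<open>x0\<close> is nonreal, or none is.\<close>
  define B where "B = Z ?c - \<real>"
  show False
  proof (cases "B = {}")
    case False
    then obtain b where "b \<in> B" by blast
    then have "order b ?C \<noteq> 0" using C by (auto simp: B_def Z_def order_root)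
    then have "(\<Sum>y\<in>B. order y ?C) \<ge> 1"
      using finZ \<open>b \<in> B\<close> member_le_sum[of b B "\<lambda>y. order y ?C"] by (simp add: B_def)
    moreover have "(\<Sum>y\<in>A \<union> B. order y ?C) = (\<Sum>y\<in>A. order y ?C) + (\<Sum>y\<in>B. order y ?C)"
      using A finZ by (intro sum.union_disjoint) (auto simp: B_def)
    moreover have "(\<Sum>y\<in>A \<union> B. order y ?C) + size (proots ?D) \<le> degree ?D"
      using A finZ D by (intro sum_order_nonreal_add_size_proots_le) (auto simp: B_def)
    moreover have "size (proots P) \<le> size (proots ?D) + 1"
      by (rule size_proots_le_pderiv[OF P0(1) D])
    ultimately show False using sumA P0(2) degD by linarith
  next
    case True
    define X where "X = Re ` Z ?c"
    have real: "y = of_real (Re y)" if "y \<in> Z ?c" for y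
      using that True by (auto simp: B_def)
    have "Z ?c = of_real ` X" using real by (force simp: X_def)
    then have "(\<Sum>y\<in>Z ?c. order y ?C) = (\<Sum>x\<in>X. order x ?D)"
      using order_of_real[OF D] by (simp add: sum.reindex inj_on_def)
    moreover have "size (proots P) + (\<Sum>x\<in>X. order x ?D) \<le> size (proots ?D) + 2"
    proof (rule size_proots_add_gap_roots_le_pderiv[OF P0(1) D _ _ free])
      show "finite X" using finZ by (simp add: X_def)
      have "\<bar>Re y - x0\<bar> < \<rho>" if "y \<in> Z ?c" for y
        using that abs_Re_le_cmod[of "y - ?c"] by (simp add: Z_def dist_norm norm_minus_commute)
      then show "X \<subseteq> {x0 - \<rho><..<x0 + \<rho>}" by (force simp: X_def abs_less_iff)
    qed
    moreover have "(\<Sum>y\<in>A. order y ?C) + size (proots ?D) \<le> degree ?D"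
      using A D by (intro sum_order_nonreal_add_size_proots_le) auto
    ultimately show False using sumA sumB P0(2) degD by linarith
  qed
qed

section \<open>The function Q at the zeros of an entire function\<close>

lemma zeros_entire: "f holomorphic_on UNIV \<Longrightarrow> zeros f = {z. f z = 0}"
  by (simp add: zeros_def entire_analytic)

lemma entire_has_derivative:
  "f holomorphic_on UNIV \<Longrightarrow> (f has_field_derivative deriv f z) (at z)"
  by (rule holomorphic_derivI[OF _ open_UNIV]) auto

lemma entire_deriv: "f holomorphic_on UNIV \<Longrightarrow> deriv f holomorphic_on UNIV"
  by (rule holomorphic_deriv) auto

lemma Qfun_eq:
  assumes "f holomorphic_on UNIV" "f z \<noteq> 0"
  shows "Qfun f z = (deriv (deriv f) z * f z - (deriv f z)\<^sup>2) / (f z)\<^sup>2"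
  unfolding Qfun_def power2_eq_square
  by (intro DERIV_imp_deriv DERIV_divide entire_has_derivative entire_deriv assms)

lemma Qfun_cong_add_const:
  assumes "open U" "z \<in> U" "\<And>w. w \<in> U \<Longrightarrow> deriv f w / f w = deriv g w / g w - c"
    "g holomorphic_on UNIV" "g z \<noteq> 0"
  shows "Qfun f z = Qfun g z"
proof -
  have d: "(\<lambda>w. deriv g w / g w) field_differentiable at z"
    unfolding field_differentiable_def
    using DERIV_divide[OF entire_has_derivative[OF entire_deriv[OF assms(4)]] entire_has_derivative[OF assms(4)] assms(5)]
    by blast
  have "Qfun f z = deriv (\<lambda>w. deriv g w / g w - c) z"
    unfolding Qfun_def using assms(1-3)
    by (intro deriv_cong_ev refl) (auto simp: eventually_nhds)
  also have "\<dots> = Qfun g z"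
    using d by (simp add: Qfun_def deriv_diff)
  finally show ?thesis .
qed

text \<open>If \<open>f = (z - a)\<^sup>n g\<close> with \<open>g a \<noteq> 0\<close>, then \<open>f'/f = n/(z - a) + g'/g\<close>, so that \<open>Q\<close> has a
  double pole with coefficient \<open>- n\<close>.\<close>
lemma Qfun_tendsto_at_zero:
  assumes f: "f holomorphic_on UNIV" "f w \<noteq> 0" "f a = 0"
  shows "\<exists>n\<noteq>0. ((\<lambda>z. (z - a)\<^sup>2 * Qfun f z) \<longlongrightarrow> n) (at a)"
proof -
  define n where "n = zorder f a"
  define g where "g = zor_poly f a"
  obtain r where n: "n > 0" and r: "r > 0" and g: "g holomorphic_on cball a r"
    and fg: "\<And>w. w \<in> cball a r \<Longrightarrow> f w = g w * (w - a) ^ nat n \<and> g w \<noteq> 0"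
  proof -
    have "\<exists>w\<in>UNIV. f w \<noteq> 0" using f(2) by blast
    from zorder_exist_zero[OF f(1) open_UNIV connected_UNIV UNIV_I this, of a] f(3)
    have "n > 0 \<and> (\<exists>r>0. g holomorphic_on cball a r \<and>
        (\<forall>w\<in>cball a r. f w = g w * (w - a) ^ nat n \<and> g w \<noteq> 0))"
      by (simp add: n_def g_def)
    then show thesis using that by blast
  qed
  define M where "M = (\<lambda>w. deriv g w / g w)"
  have gb: "g holomorphic_on ball a r" using g by (rule holomorphic_on_subset) auto
  have M: "M holomorphic_on ball a r"
    unfolding M_def using fg by (intro holomorphic_intros holomorphic_deriv gb) auto
  have L: "deriv f z / f z = of_int n / (z - a) + M z" if "z \<in> ball a r - {a}" for z
  proof -
    have "(g has_field_derivative deriv g z) (at z)"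
      using gb that by (intro holomorphic_derivI[of _ "ball a r"]) auto
    then have "((\<lambda>w. g w * (w - a) ^ nat n) has_field_derivative
        deriv g z * (z - a) ^ nat n + g z * (of_nat (nat n) * (z - a) ^ (nat n - 1))) (at z)"
      by (auto intro!: derivative_eq_intros)
    moreover have "\<forall>\<^sub>F w in nhds z. f w = g w * (w - a) ^ nat n"
      using that fg by (intro eventually_nhds_in_open[of "ball a r" z, THEN eventually_mono]) auto
    then have "deriv f z = deriv (\<lambda>w. g w * (w - a) ^ nat n) z"
      by (rule deriv_cong_ev) simp
    ultimately have "deriv f z = deriv g z * (z - a) ^ nat n + g z * (of_nat (nat n) * (z - a) ^ (nat n - 1))"
      by (simp only: DERIV_imp_deriv)
    moreover have "(z - a) ^ nat n = (z - a) * (z - a) ^ (nat n - 1)"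
      using n by (simp flip: power_Suc)
    moreover have nz: "f z = g z * (z - a) ^ nat n" "g z \<noteq> 0" "z - a \<noteq> 0" using fg that by auto
    moreover have "(of_nat (nat n) :: complex) = of_int n" using n by (simp add: of_nat_nat)
    moreover have "(b * (u * m) + c * (N * m)) / (c * (u * m)) = N / u + b / c"
      if "u \<noteq> 0" "m \<noteq> 0" "c \<noteq> 0" for b c u m N :: complex
      using that by (simp add: field_simps)
    ultimately show ?thesis
      by (simp only: M_def power_not_zero not_False_eq_True)
  qed
  have Q: "Qfun f z = - of_int n / (z - a)\<^sup>2 + deriv M z" if z: "z \<in> ball a r - {a}" for z
  proof -
    have "Qfun f z = deriv (\<lambda>w. of_int n / (w - a) + M w) z"
      unfolding Qfun_def using z L
      by (intro deriv_cong_ev eventually_nhds_in_open[of "ball a r - {a}" z, THEN eventually_mono]) auto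
    also have "\<dots> = - of_int n / (z - a)\<^sup>2 + deriv M z"
    proof (rule DERIV_imp_deriv)
      have "(M has_field_derivative deriv M z) (at z)"
        using M z by (intro holomorphic_derivI[of _ "ball a r"]) auto
      then show "((\<lambda>w. of_int n / (w - a) + M w) has_field_derivative - of_int n / (z - a)\<^sup>2 + deriv M z) (at z)"
        using z by (auto intro!: derivative_eq_intros simp: power2_eq_square)
    qed
    finally show ?thesis .
  qed
  have "deriv M holomorphic_on ball a r" using M by (intro holomorphic_deriv) auto
  then have "isCont (deriv M) a"
    using r by (intro analytic_at_imp_isCont holomorphic_on_imp_analytic_at[of _ "ball a r"]) auto
  then have "((\<lambda>z. - of_int n + (z - a)\<^sup>2 * deriv M z) \<longlongrightarrow> - of_int n + (a - a)\<^sup>2 * deriv M a) (at a)"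
    unfolding isCont_def by (intro tendsto_intros)
  then have "((\<lambda>z. (z - a)\<^sup>2 * Qfun f z) \<longlongrightarrow> - of_int n + (a - a)\<^sup>2 * deriv M a) (at a)"
  proof (rule Lim_transform_eventually)
    have "\<forall>\<^sub>F z in at a. z \<in> ball a r - {a}"
      using r by (intro eventually_at_in_open) auto
    then show "\<forall>\<^sub>F z in at a. - of_int n + (z - a)\<^sup>2 * deriv M z = (z - a)\<^sup>2 * Qfun f z"
      by eventually_elim (simp add: Q algebra_simps)
  qed
  then show ?thesis using n by (intro exI[of _ "- of_int n"]) simp
qed

text \<open>A pole of \<open>Q\<close> is not a zero of \<open>Q\<close>, whatever value the HOL function takes there, because \<open>Q\<close> is
  not analytic at the pole.\<close>
lemma Qfun_zero_imp_nonzero: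
  assumes f: "f holomorphic_on UNIV" "f w \<noteq> 0" and a: "a \<in> zeros (Qfun f)"
  shows "f a \<noteq> 0"
proof
  assume "f a = 0"
  then obtain n where n: "n \<noteq> 0" "((\<lambda>z. (z - a)\<^sup>2 * Qfun f z) \<longlongrightarrow> n) (at a)"
    using Qfun_tendsto_at_zero[OF f] by blast
  have "isCont (Qfun f) a" using a by (simp add: zeros_def analytic_at_imp_isCont)
  then have "((\<lambda>z. (z - a)\<^sup>2 * Qfun f z) \<longlongrightarrow> (a - a)\<^sup>2 * Qfun f a) (at a)"
    unfolding isCont_def by (intro tendsto_intros)
  from LIM_unique[OF this n(2)] n(1) show False by simp
qed

lemma Qfun_eventually_nonzero:
  assumes f: "f holomorphic_on UNIV" "f w \<noteq> 0" "f a = 0"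
  shows "\<forall>\<^sub>F z in at a. Qfun f z \<noteq> 0"
proof -
  obtain n where "n \<noteq> 0" "((\<lambda>z. (z - a)\<^sup>2 * Qfun f z) \<longlongrightarrow> n) (at a)"
    using Qfun_tendsto_at_zero[OF f] by blast
  then have "\<forall>\<^sub>F z in at a. (z - a)\<^sup>2 * Qfun f z \<noteq> 0"
    by (intro tendsto_imp_eventually_ne)
  then show ?thesis by eventually_elim auto
qed

section \<open>Real entire functions between a zero and the next critical point\<close>

lemma has_real_derivative_Re:
  assumes "f holomorphic_on UNIV"
  shows "((\<lambda>x. Re (f (of_real x))) has_real_derivative Re (deriv f (of_real x))) (at x)"
  by (intro has_field_derivative_Re has_vector_derivative_real_field entire_has_derivative assms)

context
  fixes f :: "complex \<Rightarrow> complex"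
  assumes f: "f holomorphic_on UNIV" and real: "\<And>x. f (of_real x) \<in> \<real>" "\<And>x. deriv f (of_real x) \<in> \<real>"
begin

lemma Rolle_real_entire:
  assumes "a < b" "f (of_real a) = 0" "f (of_real b) = 0"
  obtains x where "a < x" "x < b" "deriv f (of_real x) = 0"
proof -
  let ?F = "\<lambda>x. Re (f (of_real x))"
  obtain x where "a < x" "x < b" "?F b - ?F a = (b - a) * Re (deriv f (of_real x))"
    using MVT2[OF assms(1), of ?F "\<lambda>x. Re (deriv f (of_real x))"] has_real_derivative_Re[OF f] by blast
  then show thesis
    using that[of x] assms real(2)[of x] by (auto simp: complex_is_Real_iff complex_eq_iff)
qed

text \<open>The square of \<open>f\<close> vanishes at \<open>\<alpha>\<close> and is positive afterwards, so its derivative \<open>2 f f'\<close> is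
  positive somewhere in the interval; as neither \<open>f\<close> nor \<open>f'\<close> vanishes there, it is positive throughout.\<close>
lemma logderiv_positive_right_of_zero:
  assumes "\<alpha> < x" "f (of_real \<alpha>) = 0" and nz: "\<And>y. \<alpha> < y \<Longrightarrow> y \<le> x \<Longrightarrow> deriv f (of_real y) \<noteq> 0"
  shows "Re (f (of_real x)) * Re (deriv f (of_real x)) > 0"
proof -
  define F where "F = (\<lambda>x. Re (f (of_real x)))"
  define G where "G = (\<lambda>x. Re (deriv f (of_real x)))"
  have F: "(F has_real_derivative G x) (at x)" for x
    unfolding F_def G_def by (rule has_real_derivative_Re[OF f])
  have contG: "isCont G x" for x
    using has_real_derivative_Re[OF entire_deriv[OF f], of x] unfolding G_def by (rule DERIV_isCont)
  have G0: "G y \<noteq> 0" if "\<alpha> < y" "y \<le> x" for y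
    using nz[OF that] real(2)[of y] by (auto simp: G_def complex_is_Real_iff complex_eq_iff)
  have F0: "F y \<noteq> 0" if "\<alpha> < y" "y \<le> x" for y
  proof
    assume "F y = 0"
    then have "f (of_real y) = 0" using real(1)[of y] by (auto simp: F_def complex_is_Real_iff complex_eq_iff)
    then obtain z where "\<alpha> < z" "z < y" "deriv f (of_real z) = 0"
      using Rolle_real_entire[OF \<open>\<alpha> < y\<close> assms(2)] by blast
    then show False using nz[of z] that by auto
  qed
  have "((\<lambda>x. (F x)\<^sup>2) has_real_derivative 2 * (F y * G y)) (at y)" for y
    using F[of y] by (auto intro!: derivative_eq_intros)
  then obtain \<xi> where \<xi>: "\<alpha> < \<xi>" "\<xi> < x" "(F x)\<^sup>2 - (F \<alpha>)\<^sup>2 = (x - \<alpha>) * (2 * (F \<xi> * G \<xi>))"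
    using MVT2[OF assms(1), of "\<lambda>x. (F x)\<^sup>2" "\<lambda>y. 2 * (F y * G y)"] by blast
  have "F \<alpha> = 0" using assms(2) by (simp add: F_def)
  then have "(F \<alpha>)\<^sup>2 = 0" by simp
  moreover have "(F x)\<^sup>2 > 0" using F0[of x] assms(1) by simp
  ultimately have "(x - \<alpha>) * (2 * (F \<xi> * G \<xi>)) > 0" using \<xi>(3) by linarith
  then have pos: "F \<xi> * G \<xi> > 0" using assms(1) by (simp add: zero_less_mult_iff)
  have "F x * G x > 0"
  proof (rule ccontr)
    assume "\<not> F x * G x > 0"
    moreover have "isCont (\<lambda>y. F y * G y) y" for y
      using contG[of y] DERIV_isCont[OF F[of y]] by (intro continuous_intros)
    ultimately obtain y where "\<xi> \<le> y" "y \<le> x" "F y * G y = 0"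
      using IVT2[of "\<lambda>y. F y * G y" x 0 \<xi>] pos \<xi> by auto
    then show False using F0[of y] G0[of y] \<xi> by auto
  qed
  then show ?thesis by (simp add: F_def G_def)
qed

end

text \<open>The zeros of \<open>g\<close> are isolated, so those to the right of \<open>\<alpha>\<close> do not accumulate at
  \<open>\<alpha>\<close> and there is a first one.\<close>
lemma nearest_zero_above:
  assumes g: "g holomorphic_on UNIV" "g w \<noteq> 0" and b: "\<alpha> < b" "g (of_real b) = 0"
  obtains c where "\<alpha> < c" "g (of_real c) = (0::complex)" "\<And>x. \<alpha> < x \<Longrightarrow> x < c \<Longrightarrow> g (of_real x) \<noteq> 0"
proof -
  obtain d where d: "d > 0" "\<And>z. z \<noteq> of_real \<alpha> \<Longrightarrow> dist z (of_real \<alpha>) < d \<Longrightarrow> g z \<noteq> 0"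
    using entire_eventually_nonzero[OF g, of "of_real \<alpha>"] by (auto simp: eventually_at)
  have near: "g (of_real x) \<noteq> 0" if "\<alpha> < x" "x < \<alpha> + d" for x
    using d(2)[of "of_real x"] that by (auto simp: dist_of_real dist_real_def)
  define S where "S = {\<alpha> + d..b} \<inter> {x. g (of_real x) = 0}"
  have "continuous_on UNIV (\<lambda>x::real. g (of_real x))"
    by (intro continuous_on_compose2[OF holomorphic_on_imp_continuous_on[OF g(1)]] continuous_intros) auto
  then have "closed {x. g (of_real x) = 0}" by (intro closed_Collect_eq continuous_intros)
  then have "compact S" unfolding S_def by (intro compact_Int_closed) auto
  moreover have "b \<in> S" using near[of b] b by (force simp: S_def)
  ultimately obtain c where c: "c \<in> S" "\<And>x. x \<in> S \<Longrightarrow> c \<le> x"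
    using compact_attains_inf[of S] by blast
  show thesis
  proof
    show "\<alpha> < c" "g (of_real c) = 0" using c(1) d(1) by (auto simp: S_def)
    show "g (of_real x) \<noteq> 0" if "\<alpha> < x" "x < c" for x
      using near[of x] c(1) c(2)[of x] that by (force simp: S_def)
  qed
qed

lemma nearest_zero_below:
  assumes g: "g holomorphic_on UNIV" "g w \<noteq> 0" and b: "b < \<alpha>" "g (of_real b) = 0"
  obtains c where "c < \<alpha>" "g (of_real c) = (0::complex)" "\<And>x. c < x \<Longrightarrow> x < \<alpha> \<Longrightarrow> g (of_real x) \<noteq> 0"
proof -
  have "(\<lambda>z. g (- z)) holomorphic_on UNIV"
    using holomorphic_on_compose_gen[OF _ g(1), of uminus UNIV] by (simp add: o_def holomorphic_on_minus)
  then obtain c where c: "- \<alpha> < c" "g (- of_real c) = 0" "\<And>x. - \<alpha> < x \<Longrightarrow> x < c \<Longrightarrow> g (- of_real x) \<noteq> 0"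
    using nearest_zero_above[of "\<lambda>z. g (- z)" "- w" "- \<alpha>" "- b"] g b by auto
  show thesis
    using that[of "- c"] c(1,2) c(3)[of "- x" for x] by force
qed

context
  fixes f :: "complex \<Rightarrow> complex" and w :: complex and \<alpha> :: real
  assumes f: "f holomorphic_on UNIV" and real: "\<And>x. f (of_real x) \<in> \<real>" "\<And>x. deriv f (of_real x) \<in> \<real>"
    and nz: "deriv f w \<noteq> 0" and \<alpha>: "f (of_real \<alpha>) = 0"
begin

text \<open>If \<open>f'\<close> has no zero beyond \<open>\<alpha>\<close>, then by Rolle's theorem \<open>f\<close> has none either, and so \<open>\<alpha>\<close> is
  the largest zero and the endpoint may be infinite.\<close>
lemma right_endpoint_exists: "\<exists>\<beta>. right_endpoint f \<alpha> \<beta>"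
proof (cases "\<exists>b>\<alpha>. deriv f (of_real b) = 0")
  case True
  then obtain c where "\<alpha> < c" "deriv f (of_real c) = 0" "\<And>x. \<alpha> < x \<Longrightarrow> x < c \<Longrightarrow> deriv f (of_real x) \<noteq> 0"
    using nearest_zero_above[OF entire_deriv[OF f] nz] by blast
  then have "right_endpoint f \<alpha> (ereal c)"
    by (auto simp: right_endpoint_def zeros_entire entire_deriv f)
  then show ?thesis ..
next
  case False
  then have "\<not> f (of_real x) = 0" if "x > \<alpha>" for x
    using Rolle_real_entire[OF f real that \<alpha>] by metis
  with False have "right_endpoint f \<alpha> \<infinity>"
    by (auto simp: right_endpoint_def zeros_entire entire_deriv f not_less[symmetric])
  then show ?thesis ..
qed

lemma left_endpoint_exists: "\<exists>\<beta>. left_endpoint f \<alpha> \<beta>"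
proof (cases "\<exists>b<\<alpha>. deriv f (of_real b) = 0")
  case True
  then obtain c where "c < \<alpha>" "deriv f (of_real c) = 0" "\<And>x. c < x \<Longrightarrow> x < \<alpha> \<Longrightarrow> deriv f (of_real x) \<noteq> 0"
    using nearest_zero_below[OF entire_deriv[OF f] nz] by blast
  then have "left_endpoint f \<alpha> (ereal c)"
    by (auto simp: left_endpoint_def zeros_entire entire_deriv f)
  then show ?thesis ..
next
  case False
  then have "\<not> f (of_real x) = 0" if "x < \<alpha>" for x
    using Rolle_real_entire[OF f real that _ \<alpha>] by metis
  with False have "left_endpoint f \<alpha> (-\<infinity>)"
    by (auto simp: left_endpoint_def zeros_entire entire_deriv f not_less[symmetric])
  then show ?thesis ..
qed

text \<open>On the interval to the right of \<open>\<alpha>\<close> the logarithmic derivative is positive, which excludes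
  all zeros of \<open>Q\<close> at which it is \<open>\<le> 0\<close>. The assumption says that
  these are all zeros of \<open>Q\<close> outside the zeros of \<open>f\<close>.\<close>
lemma property_A_at_criterion:
  assumes crit: "\<And>x. Qfun f (of_real x) = 0 \<Longrightarrow> f (of_real x) \<noteq> 0 \<Longrightarrow>
      Re (deriv f (of_real x) / f (of_real x)) \<le> 0"
  shows "property_A_at f \<alpha>"
proof -
  obtain \<beta>1 where 1: "left_endpoint f \<alpha> \<beta>1" using left_endpoint_exists by blast
  obtain \<beta>2 where 2: "right_endpoint f \<alpha> \<beta>2" using right_endpoint_exists by blast
  have fnz: "\<exists>v. f v \<noteq> 0"
  proof (rule ccontr)
    assume "\<nexists>v. f v \<noteq> 0"
    then have "f = (\<lambda>_. 0)" by auto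
    then show False using nz by simp
  qed
  have "\<not> real_zero (Qfun f) x" if "\<alpha> < x" "ereal x < \<beta>2" for x
  proof
    assume Q: "real_zero (Qfun f) x"
    have "deriv f (of_real y) \<noteq> 0" if "\<alpha> < y" "y \<le> x" for y
      using 2 that \<open>ereal x < \<beta>2\<close> le_less_trans[of "ereal y" "ereal x" \<beta>2]
      by (auto simp: right_endpoint_def zeros_entire entire_deriv f)
    then have pos: "Re (f (of_real x)) * Re (deriv f (of_real x)) > 0"
      using logderiv_positive_right_of_zero[OF f real \<open>\<alpha> < x\<close> \<alpha>] by blast
    have "f (of_real x) \<noteq> 0" using fnz Qfun_zero_imp_nonzero[OF f _ Q] by blast
    then have "Re (deriv f (of_real x) / f (of_real x)) \<le> 0"
      using crit Q by (auto simp: zeros_def)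
    moreover have "Re (deriv f (of_real x) / f (of_real x)) = Re (deriv f (of_real x)) / Re (f (of_real x))"
      using real(1)[of x] real(2)[of x] by (auto elim!: Reals_cases)
    ultimately show False using pos by (auto simp: zero_less_mult_iff divide_le_0_iff)
  qed
  then show ?thesis unfolding property_A_at_def using 1 2 by blast
qed

end

section \<open>Choice of the shift\<close>

text \<open>With \<open>M = degree p\<close> and leading coefficient \<open>a\<close>, the coefficient of \<open>x\<^bsup>2M-2\<^esup>\<close> in
  \<open>p'\<^sup>2 - p p''\<close> is \<open>M\<^sup>2 a\<^sup>2 - M (M - 1) a\<^sup>2 = M a\<^sup>2 > 0\<close>.\<close>
lemma Wronskian_poly_negative_above:
  fixes p :: "real poly"
  assumes "degree p > 0"
  shows "\<exists>B. \<forall>x\<ge>B. poly p x * poly (pderiv (pderiv p)) x < (poly (pderiv p) x)\<^sup>2"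
proof -
  define M where "M = degree p"
  define a where "a = lead_coeff p"
  have M: "M > 0" and a: "a \<noteq> 0" using assms by (auto simp: M_def a_def)
  let ?w = "pderiv p * pderiv p - p * pderiv (pderiv p)"
  have d1: "degree (pderiv p) = M - 1" by (simp add: degree_pderiv M_def)
  have d2: "degree (pderiv (pderiv p)) = M - 2" by (simp add: degree_pderiv M_def numeral_2_eq_2)
  have c1: "coeff (pderiv p) (M - 1) = M * a"
    using M by (simp add: coeff_pderiv M_def a_def)
  have 1: "coeff (pderiv p * pderiv p) (M - 1 + (M - 1)) = (M * a) * (M * a)"
    using coeff_mult_degree_sum[of "pderiv p" "pderiv p"] by (simp only: d1 c1)
  have 2: "coeff (p * pderiv (pderiv p)) (M - 1 + (M - 1)) = a * (real (M - 1) * (M * a))"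
  proof (cases "M = 1")
    case True
    then have "pderiv (pderiv p) = 0" using d1 by (simp add: pderiv_eq_0_iff)
    then show ?thesis using True by simp
  next
    case False
    then have eq: "M - 1 + (M - 1) = M + (M - 2)" using M by simp
    have "coeff (pderiv (pderiv p)) (M - 2) = real (M - 1) * (M * a)"
      using False M by (simp add: coeff_pderiv M_def a_def numeral_2_eq_2 Suc_diff_Suc)
    then show ?thesis
      unfolding eq using coeff_mult_degree_sum[of p "pderiv (pderiv p)"]
      by (simp add: d2 M_def [symmetric] a_def)
  qed
  obtain k where "M = Suc k" using M by (cases M) auto
  then have c: "coeff ?w (M - 1 + (M - 1)) = M * a\<^sup>2"
    using 1 2 by (simp add: power2_eq_square algebra_simps)
  have "degree ?w \<le> M - 1 + (M - 1)"
  proof (rule degree_diff_le)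
    show "degree (pderiv p * pderiv p) \<le> M - 1 + (M - 1)"
      using degree_mult_le[of "pderiv p" "pderiv p"] by (simp add: d1)
    show "degree (p * pderiv (pderiv p)) \<le> M - 1 + (M - 1)"
    proof (cases "M = 1")
      case True
      then have "pderiv (pderiv p) = 0" using d1 by (simp add: pderiv_eq_0_iff)
      then show ?thesis by simp
    next
      case False
      then show ?thesis using degree_mult_le[of p "pderiv (pderiv p)"] M by (simp add: d2 M_def [symmetric])
    qed
  qed
  moreover have "coeff ?w (M - 1 + (M - 1)) > 0" using c M a by simp
  ultimately have lc: "lead_coeff ?w > 0"
    using le_degree[of ?w "M - 1 + (M - 1)"] by (metis le_antisym less_irrefl)
  then obtain B where "\<forall>x\<ge>B. poly ?w x \<ge> lead_coeff ?w"
    using poly_pinfty_gt_lc by blast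
  then have "\<forall>x\<ge>B. poly ?w x > 0" using lc by (meson less_le_trans)
  then show ?thesis by (intro exI[of _ B]) (simp add: power2_eq_square)
qed

text \<open>For \<open>x\<close> near \<open>-\<infinity>\<close>, the same applies to the reflected polynomial \<open>p (- x)\<close>, since two
  differentiations or a square remove the sign.\<close>
lemma Wronskian_poly_negative:
  fixes p :: "real poly"
  assumes "degree p > 0"
  obtains B where "\<And>x. \<bar>x\<bar> \<ge> B \<Longrightarrow> poly p x * poly (pderiv (pderiv p)) x < (poly (pderiv p) x)\<^sup>2"
proof -
  obtain B where B: "\<forall>x\<ge>B. poly p x * poly (pderiv (pderiv p)) x < (poly (pderiv p) x)\<^sup>2"
    using Wronskian_poly_negative_above[OF assms] by blast
  let ?r = "[:0, -1:] :: real poly"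
  have "degree (pcompose p ?r) > 0" using assms by (simp add: degree_pcompose)
  then obtain C where C: "\<forall>x\<ge>C. poly (pcompose p ?r) x * poly (pderiv (pderiv (pcompose p ?r))) x
      < (poly (pderiv (pcompose p ?r)) x)\<^sup>2"
    using Wronskian_poly_negative_above by blast
  have d: "pderiv (pcompose q ?r) = - pcompose (pderiv q) ?r" for q
    by (simp add: pderiv_pcompose pderiv_pCons)
  have C': "poly p (- x) * poly (pderiv (pderiv p)) (- x) < (poly (pderiv p) (- x))\<^sup>2" if "x \<ge> C" for x
    using C that by (simp add: d pderiv_minus poly_pcompose)
  show thesis
  proof (rule that[of "max B C"])
    show "poly p x * poly (pderiv (pderiv p)) x < (poly (pderiv p) x)\<^sup>2" if "\<bar>x\<bar> \<ge> max B C" for x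
      using B that C'[of "- x"] by (cases "x \<ge> 0") auto
  qed
qed

text \<open>The decomposition \<open>\<phi> = p f\<close> is fixed from here on; the number of nonreal zeros is the degree
  of \<open>p\<close>.\<close>
locale laguerre_polya_star_function =
  fixes p :: "real poly" and f \<phi> :: "complex \<Rightarrow> complex"
  assumes f: "f \<in> laguerre_polya" and p: "\<And>x. poly p x \<noteq> 0"
    and \<phi>: "\<And>z. \<phi> z = cpoly p z * f z"
    and not_exp: "\<not> (\<exists>(C::real) (\<beta>::real). \<forall>z. \<phi> z = of_real C * exp (of_real \<beta> * z))"
begin

definition \<psi> :: "real \<Rightarrow> complex \<Rightarrow> complex" where
  "\<psi> \<sigma> = (\<lambda>z. exp (- of_real \<sigma> * z) * \<phi> z)"

lemma p_nonzero: "p \<noteq> 0" using p[of 0] by auto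

lemma approximable_\<phi>: "approximable (degree p) \<phi>"
proof -
  have "approximable (degree p) (cpoly p)"
    using p_nonzero by (intro approximable_cpoly) (simp add: at_most_nonreal_def)
  from approximable_mult[OF this laguerre_polya_approximable_nonzero(1)[OF f]]
  show ?thesis by (simp add: \<phi> [abs_def])
qed

lemma approximable_\<psi>: "approximable (degree p) (\<psi> \<sigma>)"
proof -
  have "approximable 0 (\<lambda>z. exp (cpoly [:0, - \<sigma>:] z))"
    by (intro approximable_exp_linear) simp
  from approximable_mult[OF this approximable_\<phi>] show ?thesis
    by (simp add: \<psi>_def [abs_def] map_poly_pCons mult.commute)
qed

lemmas holomorphic_\<phi> = approximable_holomorphic[OF approximable_\<phi>]
lemmas holomorphic_\<psi> = approximable_holomorphic[OF approximable_\<psi>]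

lemma \<psi>_in_laguerre_polya_star: "\<psi> \<sigma> \<in> laguerre_polya_star"
proof -
  obtain c d \<gamma> q l \<omega> \<alpha> where *: "c \<noteq> 0" "\<gamma> \<ge> 0" "degree q \<le> 1" "l \<le> 1"
    "\<forall>j. enat j < \<omega> \<longrightarrow> \<alpha> j \<noteq> 0"
    "summable (\<lambda>j. if enat j < \<omega> then 1 / \<bar>\<alpha> j\<bar> ^ (l + 1) else 0)"
    "\<forall>z. f z = of_real c * z ^ d * exp (- of_real \<gamma> * z ^ 2 + cpoly q z) *
                (\<Prod>j. weierstrass_factor \<omega> l \<alpha> j z)"
    using f unfolding laguerre_polya_def by blast
  define q' where "q' = q + [:0, - \<sigma>:]"
  have q': "cpoly q' z = cpoly q z - of_real \<sigma> * z" for z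
  proof -
    have "map_poly complex_of_real q' = map_poly complex_of_real q + map_poly complex_of_real [:0, - \<sigma>:]"
      by (rule poly_eqI) (simp add: q'_def coeff_map_poly)
    then show ?thesis by (simp add: map_poly_pCons mult.commute)
  qed
  let ?g = "\<lambda>z. exp (- of_real \<sigma> * z) * f z"
  have "degree q' \<le> 1" unfolding q'_def using *(3) by (intro degree_add_le) auto
  moreover have "\<forall>z. ?g z = of_real c * z ^ d * exp (- of_real \<gamma> * z ^ 2 + cpoly q' z) *
                (\<Prod>j. weierstrass_factor \<omega> l \<alpha> j z)"
    using *(7) by (simp add: q' exp_add exp_diff exp_minus field_simps)
  ultimately have "?g \<in> laguerre_polya"
    unfolding laguerre_polya_def using *(1,2,4-6) by blast
  then show ?thesis unfolding laguerre_polya_star_def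
    by (auto simp: \<psi>_def \<phi> p intro!: bexI[of _ ?g] exI[of _ p])
qed

lemma \<psi>_eq_0_iff: "\<psi> \<sigma> z = 0 \<longleftrightarrow> \<phi> z = 0"
  by (simp add: \<psi>_def)

lemma \<phi>_nonzero: "\<exists>w. \<phi> w \<noteq> 0"
proof (rule ccontr)
  assume "\<nexists>w. \<phi> w \<noteq> 0"
  then have "\<forall>z. \<phi> z = of_real 0 * exp (of_real 0 * z)" by simp
  then show False using not_exp by blast
qed

lemma deriv_\<psi>: "deriv (\<psi> \<sigma>) z = exp (- of_real \<sigma> * z) * (deriv \<phi> z - of_real \<sigma> * \<phi> z)"
  unfolding \<psi>_def
  by (rule DERIV_imp_deriv)
    (auto intro!: derivative_eq_intros entire_has_derivative[OF holomorphic_\<phi>] simp: algebra_simps)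

text \<open>This is where \<open>\<phi> \<noteq> C exp (\<beta> z)\<close> is essential: if \<open>\<psi>\<close> is constant, \<open>\<phi>\<close> has the excluded form.\<close>
lemma deriv_\<psi>_nonzero: "\<exists>w. deriv (\<psi> \<sigma>) w \<noteq> 0"
proof (rule ccontr)
  assume "\<nexists>w. deriv (\<psi> \<sigma>) w \<noteq> 0"
  then have "(\<psi> \<sigma> has_field_derivative 0) (at z)" for z
    using entire_has_derivative[OF holomorphic_\<psi>, of \<sigma> z] by simp
  then obtain c where c: "\<And>z. \<psi> \<sigma> z = c"
    using has_field_derivative_zero_constant[of UNIV "\<psi> \<sigma>"] by auto
  then have "c \<in> \<real>" using approximable_real_on_reals(1)[OF approximable_\<psi>, of \<sigma> 0] by simp
  then obtain C where C: "c = of_real C" by (auto elim: Reals_cases)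
  have "\<phi> z = of_real C * exp (of_real \<sigma> * z)" for z
    using c[of z] C by (simp add: \<psi>_def exp_minus field_simps)
  then show False using not_exp by blast
qed

lemma Qfun_\<psi>: "\<phi> z \<noteq> 0 \<Longrightarrow> Qfun (\<psi> \<sigma>) z = Qfun \<phi> z"
proof (rule Qfun_cong_add_const[of "{z. \<phi> z \<noteq> 0}" _ _ _ "of_real \<sigma>"])
  show "open {z. \<phi> z \<noteq> 0}"
    by (intro open_Collect_neq holomorphic_on_imp_continuous_on holomorphic_\<phi> continuous_on_const)
  show "deriv (\<psi> \<sigma>) w / \<psi> \<sigma> w = deriv \<phi> w / \<phi> w - of_real \<sigma>" if "w \<in> {z. \<phi> z \<noteq> 0}" for w
    using that by (simp add: deriv_\<psi>) (simp add: \<psi>_def field_simps)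
qed (auto simp: holomorphic_\<phi>)

text \<open>The other factors \<open>exp (- \<sigma> z)\<close> and \<open>f\<close> have no nonreal zeros, and all zeros of \<open>p\<close> are
  nonreal.\<close>
lemma Z_C_\<psi>: "Z_C (\<psi> \<sigma>) = enat (degree p)"
proof -
  let ?C = "map_poly complex_of_real p"
  let ?e = "\<lambda>z. exp (- of_real \<sigma> * z) * f z"
  have C: "?C \<noteq> 0" using p_nonzero by (simp add: map_poly_of_real_eq_0_iff)
  have fh: "f holomorphic_on A" for A
    by (rule approximable_holomorphic[OF laguerre_polya_approximable_nonzero(1)[OF f]])
  have fnz: "f z \<noteq> 0" if "z \<notin> \<real>" for z
    using laguerre_polya_approximable_nonzero(2)[OF f that] .
  have eh: "?e holomorphic_on UNIV" by (intro holomorphic_intros fh)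
  have nonreal: "z \<notin> \<real>" if "poly ?C z = 0" for z
    using that p by (auto elim!: Reals_cases)
  have Z: "zeros (\<psi> \<sigma>) \<inter> - \<real> = {z. poly ?C z = 0}"
    using fnz nonreal by (auto simp: zeros_entire[OF holomorphic_\<psi>] \<psi>_eq_0_iff \<phi>)
  have ord: "zorder (\<psi> \<sigma>) z = int (order z ?C)" if "poly ?C z = 0" for z
  proof -
    have nz: "?e z \<noteq> 0" using fnz[OF nonreal[OF that]] by simp
    have "\<psi> \<sigma> = (\<lambda>z. poly ?C z * ?e z)" by (auto simp: \<psi>_def \<phi>)
    then have "zorder (\<psi> \<sigma>) z = zorder (\<lambda>z. poly ?C z * ?e z) z" by simp
    also have "\<dots> = zorder (poly ?C) z + zorder ?e z"
    proof (rule zorder_times_analytic)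
      obtain b where "poly ?C b \<noteq> 0" using C by (metis poly_all_0_iff_0)
      then have "\<forall>\<^sub>F w in at z. poly ?C w \<noteq> 0"
        by (intro entire_eventually_nonzero[of "poly ?C" b] holomorphic_intros)
      moreover have "\<forall>\<^sub>F w in at z. ?e w \<noteq> 0"
        using eh nz by (intro entire_eventually_nonzero[of ?e z])
      ultimately show "\<forall>\<^sub>F w in at z. poly ?C w * ?e w \<noteq> 0"
        by eventually_elim simp
    qed (intro entire_analytic holomorphic_intros fh)+
    also have "zorder ?e z = 0"
      by (rule zorder_eq_0I) (use nz entire_analytic[OF eh] in auto)
    finally show ?thesis by (simp add: zorder_poly C)
  qed
  have fin: "finite {z. poly ?C z = 0}" using C by (rule poly_roots_finite)
  have "(\<Sum>z\<in>{z. poly ?C z = 0}. nat (zorder (\<psi> \<sigma>) z)) = (\<Sum>z\<in>{z. poly ?C z = 0}. order z ?C)"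
    using ord by (intro sum.cong) auto
  also have "\<dots> = size (proots ?C)"
    using C fin by (intro size_proots_eq_sum [symmetric]) auto
  also have "\<dots> = degree p" by (simp add: size_proots_complex degree_map_poly_of_real)
  finally show ?thesis using fin by (simp add: Z_C_def count_zeros_def Z)
qed

text \<open>The real critical points of \<open>\<phi>'/\<phi>\<close>. Zeros of \<open>\<phi>\<close> have to be excluded explicitly, as
  \<open>Qfun \<phi>\<close> has an arbitrary value there.\<close>
definition critical_points :: "real set" where
  "critical_points = {x. \<phi> (of_real x) \<noteq> 0 \<and> Qfun \<phi> (of_real x) = 0}"

definition logderiv :: "real \<Rightarrow> real" where
  "logderiv x = Re (deriv \<phi> (of_real x) / \<phi> (of_real x))"

lemma deriv_eq_logderiv_mult:
  assumes "\<phi> (of_real x) \<noteq> 0"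
  shows "deriv \<phi> (of_real x) = of_real (logderiv x) * \<phi> (of_real x)"
proof -
  have "deriv \<phi> (of_real x) / \<phi> (of_real x) \<in> \<real>"
    by (intro Reals_divide approximable_real_on_reals[OF approximable_\<phi>])
  then have "of_real (logderiv x) = deriv \<phi> (of_real x) / \<phi> (of_real x)"
    by (auto simp: logderiv_def elim: Reals_cases)
  then show ?thesis using assms by simp
qed

text \<open>With \<open>\<sigma> = (\<phi>'/\<phi>)(x)\<close> one gets \<open>\<psi>' = 0\<close> at \<open>x\<close>, and then \<open>\<psi> \<psi>'' = \<psi>'\<^sup>2 + Q \<psi>\<^sup>2 = 0\<close>,
  so the zero of \<open>\<psi>'\<close> is at least double.\<close>
lemma Z_C_deriv_less:
  assumes "x \<in> critical_points"
  shows "Z_C (deriv (\<psi> (logderiv x))) < enat (degree p)"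
proof -
  let ?\<psi> = "\<psi> (logderiv x)" and ?x = "complex_of_real x"
  have x: "\<phi> ?x \<noteq> 0" "Qfun \<phi> ?x = 0" using assms by (auto simp: critical_points_def)
  have 1: "deriv ?\<psi> ?x = 0" using deriv_eq_logderiv_mult[OF x(1)] by (simp add: deriv_\<psi>)
  have "Qfun ?\<psi> ?x = 0" using x by (simp add: Qfun_\<psi>)
  then have 2: "deriv (deriv ?\<psi>) ?x = 0"
    using x(1) 1 by (simp add: Qfun_eq holomorphic_\<psi> \<psi>_eq_0_iff)
  obtain w where "deriv ?\<psi> w \<noteq> 0" using deriv_\<psi>_nonzero by blast
  then show ?thesis
    using nonreal_zeros_deriv_less[OF approximable_\<psi> _ _ 1 2] x(1) by (simp add: \<psi>_eq_0_iff)
qed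

text \<open>Near infinity, \<open>Q\<close> is negative if \<open>p\<close> is not constant: the Laguerre inequality for \<open>f\<close> and the
  strict inequality for \<open>p\<close> add up. If \<open>p\<close> is constant, a critical point would give a derivative with
  fewer than 0 nonreal zeros.\<close>
lemma bounded_critical_points: "bounded critical_points"
proof (cases "degree p = 0")
  case True
  then have "critical_points = {}" using Z_C_deriv_less by (force simp: enat_0)
  then show ?thesis by simp
next
  case False
  then obtain B where B: "\<And>x. \<bar>x\<bar> \<ge> B \<Longrightarrow> poly p x * poly (pderiv (pderiv p)) x < (poly (pderiv p) x)\<^sup>2"
    using Wronskian_poly_negative[of p] by auto
  have af: "approximable 0 f" by (rule laguerre_polya_approximable_nonzero(1)[OF f])
  note fh = approximable_holomorphic[OF af]
  have "\<bar>x\<bar> \<le> B" if "x \<in> critical_points" for x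
  proof (rule ccontr)
    assume "\<not> \<bar>x\<bar> \<le> B"
    let ?x = "complex_of_real x"
    have x: "\<phi> ?x \<noteq> 0" "Qfun \<phi> ?x = 0" using that by (auto simp: critical_points_def)
    define P P' P'' where P: "P = poly p x" "P' = poly (pderiv p) x" "P'' = poly (pderiv (pderiv p)) x"
    define F F' F'' where F: "F = Re (f ?x)" "F' = Re (deriv f ?x)" "F'' = Re (deriv (deriv f) ?x)"
    have fr: "f ?x = of_real F" "deriv f ?x = of_real F'" "deriv (deriv f) ?x = of_real F''"
      using approximable_real_on_reals[OF af, of x] by (auto simp: F complex_is_Real_iff complex_eq_iff)
    have dp: "(cpoly q has_field_derivative cpoly (pderiv q) z) (at z)" for q z
      by (simp add: map_poly_of_real_pderiv poly_DERIV)
    have d1: "deriv \<phi> = (\<lambda>z. cpoly (pderiv p) z * f z + deriv f z * cpoly p z)"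
      unfolding \<phi> [abs_def]
      by (intro ext DERIV_imp_deriv DERIV_mult dp entire_has_derivative fh)
    have d2: "deriv (deriv \<phi>) ?x = (cpoly (pderiv (pderiv p)) ?x * f ?x + deriv f ?x * cpoly (pderiv p) ?x)
        + (deriv (deriv f) ?x * cpoly p ?x + cpoly (pderiv p) ?x * deriv f ?x)"
      unfolding d1
      by (intro DERIV_imp_deriv DERIV_add DERIV_mult dp entire_has_derivative entire_deriv fh)
    have "0 = deriv (deriv \<phi>) ?x * \<phi> ?x - (deriv \<phi> ?x)\<^sup>2"
      using x by (simp add: Qfun_eq holomorphic_\<phi>)
    also have "\<dots> = of_real (F\<^sup>2 * (P * P'' - P'\<^sup>2) + P\<^sup>2 * (F * F'' - F'\<^sup>2))"
      unfolding d2 unfolding d1 \<phi> fr cpoly_of_real P [symmetric]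
      by (simp add: power2_eq_square algebra_simps)
    finally have "F\<^sup>2 * (P * P'' - P'\<^sup>2) + P\<^sup>2 * (F * F'' - F'\<^sup>2) = 0"
      by (metis of_real_eq_0_iff)
    moreover have "F\<^sup>2 > 0" using x(1) fr(1) by (auto simp: \<phi>)
    then have "F\<^sup>2 * (P * P'' - P'\<^sup>2) < 0"
      using B[of x] \<open>\<not> \<bar>x\<bar> \<le> B\<close> by (simp add: P mult_less_0_iff)
    moreover have "P\<^sup>2 * (F * F'' - F'\<^sup>2) \<le> 0"
      using Laguerre_inequality[OF af, of x] by (simp add: F mult_le_0_iff)
    ultimately show False by linarith
  qed
  then show ?thesis unfolding bounded_iff by auto
qed

text \<open>Critical points cannot accumulate at a zero of \<open>\<phi>\<close>, because \<open>Q\<close> has a pole there; elsewhere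
  they are the zeros of the continuous function \<open>\<phi>'' \<phi> - \<phi>'\<^sup>2\<close>.\<close>
lemma closed_critical_points: "closed critical_points"
proof -
  have "open (- critical_points)"
  proof (subst open_subopen, intro ballI)
    fix x assume x: "x \<in> - critical_points"
    have "\<forall>\<^sub>F z in nhds (complex_of_real x). z = of_real x \<or> \<not> (\<phi> z \<noteq> 0 \<and> Qfun \<phi> z = 0)"
    proof (cases "\<phi> (of_real x) = 0")
      case True
      then have "\<forall>\<^sub>F z in at (of_real x). Qfun \<phi> z \<noteq> 0"
        using \<phi>_nonzero Qfun_eventually_nonzero[OF holomorphic_\<phi>] by blast
      then show ?thesis by (auto simp: eventually_at_filter elim: eventually_mono)
    next
      case False
      let ?W = "\<lambda>z. deriv (deriv \<phi>) z * \<phi> z - (deriv \<phi> z)\<^sup>2"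
      have "Qfun \<phi> (of_real x) \<noteq> 0" using x False by (auto simp: critical_points_def)
      then have "?W (of_real x) \<noteq> 0" using False by (auto simp: Qfun_eq holomorphic_\<phi>)
      moreover have "?W holomorphic_on UNIV"
        by (intro holomorphic_intros entire_deriv holomorphic_\<phi>)
      then have "open {z. ?W z \<noteq> 0}"
        by (intro open_Collect_neq holomorphic_on_imp_continuous_on continuous_on_const)
      ultimately have "\<forall>\<^sub>F z in nhds (of_real x). z \<in> {z. ?W z \<noteq> 0}"
        by (intro eventually_nhds_in_open) auto
      then show ?thesis
        by eventually_elim (auto simp: Qfun_eq holomorphic_\<phi>)
    qed
    then obtain S where S: "open S" "of_real x \<in> S"
        "\<And>z. z \<in> S \<Longrightarrow> z = of_real x \<or> \<not> (\<phi> z \<noteq> 0 \<and> Qfun \<phi> z = 0)"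
      by (auto simp: eventually_nhds)
    have "open (complex_of_real -` S)" using S(1) by (intro open_vimage continuous_intros) auto
    moreover have "complex_of_real -` S \<subseteq> - critical_points" using S(3) x by (force simp: critical_points_def)
    ultimately show "\<exists>T. open T \<and> x \<in> T \<and> T \<subseteq> - critical_points" using S(2) by (intro exI[of _ "complex_of_real -` S"]) auto
  qed
  then show ?thesis by (simp add: closed_def)
qed

lemma continuous_on_logderiv: "continuous_on critical_points logderiv"
proof -
  have c: "continuous_on critical_points (\<lambda>x. h (complex_of_real x))" if "h holomorphic_on UNIV" for h
    by (rule continuous_on_compose2[OF holomorphic_on_imp_continuous_on[OF that]]) (auto intro!: continuous_intros)
  show ?thesis unfolding logderiv_def
    by (intro continuous_intros c holomorphic_\<phi> entire_deriv) (auto simp: critical_points_def)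
qed

lemma exists_maximal_critical_value:
  assumes "critical_points \<noteq> {}"
  obtains x0 where "x0 \<in> critical_points" "\<And>x. x \<in> critical_points \<Longrightarrow> logderiv x \<le> logderiv x0"
  using continuous_attains_sup[OF _ assms continuous_on_logderiv] bounded_critical_points closed_critical_points
  by (auto simp: compact_eq_bounded_closed)

lemma property_A_\<psi>:
  assumes "\<And>x. x \<in> critical_points \<Longrightarrow> logderiv x \<le> \<sigma>"
  shows "property_A (\<psi> \<sigma>)"
  unfolding property_A_def
proof (intro conjI allI impI \<psi>_in_laguerre_polya_star)
  fix \<alpha> assume "real_zero (\<psi> \<sigma>) \<alpha>"
  then have \<alpha>: "\<psi> \<sigma> (of_real \<alpha>) = 0" by (simp add: zeros_def)
  obtain w where w: "deriv (\<psi> \<sigma>) w \<noteq> 0" using deriv_\<psi>_nonzero by blast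
  show "property_A_at (\<psi> \<sigma>) \<alpha>"
  proof (rule property_A_at_criterion[OF holomorphic_\<psi> approximable_real_on_reals(1,2)[OF approximable_\<psi>] w \<alpha>])
    fix x assume *: "Qfun (\<psi> \<sigma>) (of_real x) = 0" "\<psi> \<sigma> (of_real x) \<noteq> 0"
    then have nz: "\<phi> (of_real x) \<noteq> 0" by (simp add: \<psi>_eq_0_iff)
    then have "x \<in> critical_points" using * by (simp add: critical_points_def Qfun_\<psi>)
    have "deriv (\<psi> \<sigma>) (of_real x) / \<psi> \<sigma> (of_real x) = of_real (logderiv x - \<sigma>)"
      using nz by (simp add: deriv_\<psi> deriv_eq_logderiv_mult[OF nz]) (simp add: \<psi>_def field_simps)
    then show "Re (deriv (\<psi> \<sigma>) (of_real x) / \<psi> \<sigma> (of_real x)) \<le> 0"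
      using assms[OF \<open>x \<in> critical_points\<close>] by simp
  qed
qed

lemma Z_R_Qfun_nonzero_imp: "Z_R (Qfun \<phi>) \<noteq> 0 \<Longrightarrow> critical_points \<noteq> {}"
proof
  assume "Z_R (Qfun \<phi>) \<noteq> 0" and critical_points: "critical_points = {}"
  have "zeros (Qfun \<phi>) \<inter> \<real> = {}"
  proof (rule ccontr)
    assume "zeros (Qfun \<phi>) \<inter> \<real> \<noteq> {}"
    then obtain x where x: "real_zero (Qfun \<phi>) x" by (auto elim!: Reals_cases)
    then have "x \<in> critical_points"
      using \<phi>_nonzero Qfun_zero_imp_nonzero[OF holomorphic_\<phi> _ x] by (auto simp: critical_points_def zeros_def)
    then show False using critical_points by simp
  qed
  then show False using \<open>Z_R (Qfun \<phi>) \<noteq> 0\<close> by (simp add: Z_R_def count_zeros_def enat_0)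
qed

text \<open>The maximal critical value serves both purposes: property A needs it to be an upper bound for the
  critical values, and the double zero of \<open>\<psi>'\<close> needs it to be one of them.\<close>
lemma exists_shift: "\<exists>\<sigma>. property_A (\<psi> \<sigma>) \<and> (Z_R (Qfun \<phi>) \<noteq> 0 \<longrightarrow> Z_C (deriv (\<psi> \<sigma>)) < Z_C (\<psi> \<sigma>))"
proof (cases "critical_points = {}")
  case True
  then show ?thesis using property_A_\<psi>[of 0] Z_R_Qfun_nonzero_imp by blast
next
  case False
  then obtain x0 where x0: "x0 \<in> critical_points" "\<And>x. x \<in> critical_points \<Longrightarrow> logderiv x \<le> logderiv x0"
    using exists_maximal_critical_value by blast
  then show ?thesis
    using property_A_\<psi>[OF x0(2)] Z_C_deriv_less[OF x0(1)] by (auto simp: Z_C_\<psi>)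
qed

end

theorem theorem1p25:
  fixes \<phi> :: "complex \<Rightarrow> complex"
  assumes "\<phi> \<in> laguerre_polya_star"
    and "\<not> (\<exists>(C::real) (\<beta>::real). \<forall>z. \<phi> z = of_real C * exp (of_real \<beta> * z))"
  shows "\<exists>\<sigma>::real. let \<psi> = (\<lambda>z. exp (- of_real \<sigma> * z) * \<phi> z) in
           property_A \<psi> \<and> (Z_R (Qfun \<phi>) \<noteq> 0 \<longrightarrow> Z_C (deriv \<psi>) < Z_C \<psi>)"
proof -
  obtain f p where "f \<in> laguerre_polya" "\<forall>x. poly p x \<noteq> 0" "\<forall>z. \<phi> z = cpoly p z * f z"
    using assms(1) unfolding laguerre_polya_star_def by blast
  then interpret laguerre_polya_star_function p f \<phi>
    using assms(2) by unfold_locales auto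
  show ?thesis using exists_shift unfolding \<psi>_def Let_def .
qed

end
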